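(* Let $(h,\nabla,\nabla^* )$ be a dually flat structure on a manifold $M$ of dimension $n$, and let $TM$ be endowed with the Kähler structure $(g,J,\omega)$ associated to $(h,\nabla)$ via Dombrowski's construction. Let $(x_i)$ and $(y_i)$ be coordinate systems on an open set $U\subseteq M$, affine with respect to $\nabla$ and $\nabla^*$ respectively, which are dual to each other, i.e. $h\big(\frac{\partial}{\partial x_i},\frac{\partial}{\partial y_j}\big)=\delta_{ij}$ for all $i,j$. Then the function $y_i\circ\pi:\pi^{-1}(U)\to\mathbb{R}$ is Kähler for all $i=1,\dots,n$, where $\pi:TM\to M$ is the canonical projection.
   Context: Let $h$ be a Riemannian metric and $\nabla$ an affine connection on $M$. The dual connection $\nabla^*$ is the unique connection with $X(h(Y,Z))=h(\nabla_XY,Z)+h(Y,\nabla^*_XZ)$; $(h,\nabla,\nabla^* )$ is dually flat if both $\nabla$ and $\nabla^*$ have zero torsion and zero curvature. Coordinates are affine with respect to a flat connection if all its Christoffel symbols vanish in them. Dombrowski's construction: let $K:T(TM)\to TM$ be the connector of $\nabla$ (the unique map with $\nabla_XY=K\,Y_*X$). Identify $A\in T_{u}(TM)$, $u\in T_pM$, with $(u,v,w)=(u,\pi_*A,KA)$; then $g_u((u,v,w),(u,\bar v,\bar w))=h_p(v,\bar v)+h_p(w,\bar w)$, $J_u(u,v,w)=(u,-w,v)$, $\omega=g(J\cdot,\cdot)$. It is Kähler when the structure is dually flat. A smooth function $f$ on a Kähler manifold is Kähler if $\mathscr{L}_{X_f}g=0$, where $X_f$ is the Hamiltonian vector field ($\omega(X_f,\cdot)=df$).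 *)

theory Defs
  imports "HOL-Analysis.Analysis" "HOL-Library.Function_Algebras"
begin

section \<open>Smooth maps between Euclidean spaces\<close>

text \<open>To be used on open sets: \<open>f\<close> is of class \<open>C\<^sup>k\<close> on \<open>S\<close>.\<close>

primrec Ck_on :: "nat \<Rightarrow> ('e::euclidean_space \<Rightarrow> 'f::real_normed_vector) \<Rightarrow> 'e set \<Rightarrow> bool" where
  "Ck_on 0 f S \<longleftrightarrow> continuous_on S f"
| "Ck_on (Suc k) f S \<longleftrightarrow>
     (\<forall>x\<in>S. f differentiable (at x)) \<and>
     (\<forall>b\<in>Basis. Ck_on k (\<lambda>x. frechet_derivative f (at x) b) S)"

definition smooth_on :: "('e::euclidean_space \<Rightarrow> 'f::real_normed_vector) \<Rightarrow> 'e set \<Rightarrow> bool" where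
  "smooth_on f S \<longleftrightarrow> (\<forall>k. Ck_on k f S)"


section \<open>Manifolds\<close>

text \<open>
  A manifold is given by a smooth atlas: a set of charts \<open>(U, \<phi>)\<close> whose domains cover the
  underlying set, with \<open>\<phi>\<close> injective on \<open>U\<close> and with open image. The topology is the one
  induced by the atlas. Values of \<open>\<phi>\<close> outside \<open>U\<close> are irrelevant.
\<close>

type_synonym ('a, 'e) chart = "'a set \<times> ('a \<Rightarrow> 'e)"
type_synonym ('a, 'e) atlas = "('a, 'e) chart set"

definition carrier_of :: "('a, 'e::euclidean_space) atlas \<Rightarrow> 'a set" where
  "carrier_of M = (\<Union>c\<in>M. fst c)"

definition compatible :: "('a, 'e::euclidean_space) chart \<Rightarrow> ('a, 'e) chart \<Rightarrow> bool" where
  "compatible c d \<longleftrightarrow> (case (c, d) of ((U, \<phi>), (V, \<psi>)) \<Rightarrow>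
     open (\<phi> ` (U \<inter> V)) \<and> open (\<psi> ` (U \<inter> V)) \<and>
     smooth_on (\<lambda>z. \<psi> (inv_into U \<phi> z)) (\<phi> ` (U \<inter> V)) \<and>
     smooth_on (\<lambda>z. \<phi> (inv_into V \<psi> z)) (\<psi> ` (U \<inter> V)))"

definition smooth_atlas :: "('a, 'e::euclidean_space) atlas \<Rightarrow> bool" where
  "smooth_atlas M \<longleftrightarrow>
     (\<forall>(U, \<phi>)\<in>M. inj_on \<phi> U \<and> open (\<phi> ` U)) \<and> (\<forall>c\<in>M. \<forall>d\<in>M. compatible c d)"

definition open_set :: "('a, 'e::euclidean_space) atlas \<Rightarrow> 'a set \<Rightarrow> bool" where
  "open_set M W \<longleftrightarrow> W \<subseteq> carrier_of M \<and> (\<forall>(U, \<phi>)\<in>M. open (\<phi> ` (U \<inter> W)))"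

lemma istopology_open_set:
  assumes "smooth_atlas M"
  shows "istopology (open_set M)"
  unfolding istopology_def
proof (intro conjI allI impI)
  fix S T assume S: "open_set M S" and T: "open_set M T"
  have "open (\<phi> ` (U \<inter> (S \<inter> T)))" if c: "(U, \<phi>) \<in> M" for U \<phi>
  proof -
    have "inj_on \<phi> U" using assms c by (auto simp: smooth_atlas_def)
    then have "\<phi> ` (U \<inter> (S \<inter> T)) = \<phi> ` (U \<inter> S) \<inter> \<phi> ` (U \<inter> T)"
      by (auto simp: inj_on_def)
    with S T c show ?thesis by (auto simp: open_set_def)
  qed
  with S T show "open_set M (S \<inter> T)" by (auto simp: open_set_def)
next
  fix \<K> assume K: "\<forall>S\<in>\<K>. open_set M S"
  have "open (\<phi> ` (U \<inter> \<Union>\<K>))" if c: "(U, \<phi>) \<in> M" for U \<phi>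
  proof -
    have "\<phi> ` (U \<inter> \<Union>\<K>) = (\<Union>S\<in>\<K>. \<phi> ` (U \<inter> S))" by auto
    moreover have "open (\<phi> ` (U \<inter> S))" if "S \<in> \<K>" for S
      using K c that unfolding open_set_def by blast
    ultimately show ?thesis by auto
  qed
  with K show "open_set M (\<Union>\<K>)" by (fastforce simp: open_set_def)
qed

definition manifold_topology :: "('a, 'e::euclidean_space) atlas \<Rightarrow> 'a topology" where
  "manifold_topology M = topology (open_set M)"

definition smooth_manifold :: "('a, 'e::euclidean_space) atlas \<Rightarrow> bool" where
  "smooth_manifold M \<longleftrightarrow> smooth_atlas M \<and>
     Hausdorff_space (manifold_topology M) \<and> second_countable (manifold_topology M)"

definition coordinate_system ::
  "('a, 'e::euclidean_space) atlas \<Rightarrow> 'a set \<Rightarrow> ('a \<Rightarrow> 'e) \<Rightarrow> bool" where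
  "coordinate_system M U x \<longleftrightarrow>
     open_set M U \<and> inj_on x U \<and> open (x ` U) \<and> (\<forall>c\<in>M. compatible (U, x) c)"

definition smooth_fun :: "('a, 'e::euclidean_space) atlas \<Rightarrow> 'a set \<Rightarrow> ('a \<Rightarrow> real) \<Rightarrow> bool" where
  "smooth_fun M W f \<longleftrightarrow> open_set M W \<and>
     (\<forall>(U, \<phi>)\<in>M. smooth_on (\<lambda>z. f (inv_into U \<phi> z)) (\<phi> ` (U \<inter> W)))"

definition smooth_near :: "('a, 'e::euclidean_space) atlas \<Rightarrow> 'a \<Rightarrow> ('a \<Rightarrow> real) \<Rightarrow> bool" where
  "smooth_near M p f \<longleftrightarrow> (\<exists>W. p \<in> W \<and> smooth_fun M W f)"


section \<open>Tangent vectors, tangent bundle, vector fields\<close>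

text \<open>
  A tangent vector at \<open>p\<close> is the velocity of a smooth curve through \<open>p\<close>, i.e. the operator
  \<open>f \<mapsto> (f \<circ> \<gamma>)'(0)\<close> on functions smooth near \<open>p\<close>. By convention it is \<open>0\<close> on functions that
  are not smooth near \<open>p\<close>, so that equality of operators is equality of tangent vectors at \<open>p\<close>.
  The vector space operations are the pointwise ones.
\<close>

type_synonym 'a tvec = "('a \<Rightarrow> real) \<Rightarrow> real"
type_synonym 'a tpoint = "'a \<times> 'a tvec"

definition scale :: "real \<Rightarrow> 'a tvec \<Rightarrow> 'a tvec"  (infixr \<open>\<cdot>\<close> 75) where
  "c \<cdot> v = (\<lambda>f. c * v f)"

definition velocity :: "('a, 'e::euclidean_space) atlas \<Rightarrow> (real \<Rightarrow> 'a) \<Rightarrow> 'a tvec" where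
  "velocity M \<gamma> = (\<lambda>f. if smooth_near M (\<gamma> 0) f then deriv (\<lambda>t. f (\<gamma> t)) 0 else 0)"

definition smooth_curve :: "('a, 'e::euclidean_space) atlas \<Rightarrow> (real \<Rightarrow> 'a) \<Rightarrow> bool" where
  "smooth_curve M \<gamma> \<longleftrightarrow> (\<exists>(U, \<phi>)\<in>M. \<exists>\<epsilon>>0.
     \<gamma> ` {-\<epsilon><..<\<epsilon>} \<subseteq> U \<and> smooth_on (\<lambda>t. \<phi> (\<gamma> t)) {-\<epsilon><..<\<epsilon>})"

definition tangent_space :: "('a, 'e::euclidean_space) atlas \<Rightarrow> 'a \<Rightarrow> 'a tvec set" where
  "tangent_space M p = {velocity M \<gamma> |\<gamma>. smooth_curve M \<gamma> \<and> \<gamma> 0 = p}"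

text \<open>
  The tangent bundle as a manifold: its points are the pairs \<open>(p, v)\<close> with \<open>v\<close> tangent at \<open>p\<close>,
  and \<open>\<pi>\<close> is \<^const>\<open>fst\<close>. A chart \<open>\<phi>\<close> of \<open>M\<close> gives the chart \<open>(p, v) \<mapsto> (\<phi>(p), d\<phi>(v))\<close>.
\<close>

definition tangent_chart :: "('a, 'e::euclidean_space) atlas \<Rightarrow> ('a, 'e) chart \<Rightarrow>
    ('a tpoint, 'e \<times> 'e) chart" where
  "tangent_chart M c = (case c of (U, \<phi>) \<Rightarrow>
     ({(p, v). p \<in> U \<and> v \<in> tangent_space M p},
      \<lambda>(p, v). (\<phi> p, \<Sum>b\<in>Basis. v (\<lambda>q. \<phi> q \<bullet> b) *\<^sub>R b)))"

definition tangent_bundle :: "('a, 'e::euclidean_space) atlas \<Rightarrow>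
    ('a tpoint, 'e \<times> 'e) atlas" where
  "tangent_bundle M = tangent_chart M ` M"

text \<open>The differential at \<open>p\<close> of a smooth map \<open>F\<close> from \<open>M\<close> to \<open>N\<close>.\<close>

definition push_forward :: "('a, 'e::euclidean_space) atlas \<Rightarrow> ('b, 'f::euclidean_space) atlas \<Rightarrow>
    ('a \<Rightarrow> 'b) \<Rightarrow> 'a \<Rightarrow> 'a tvec \<Rightarrow> 'b tvec" where
  "push_forward M N F p v = (\<lambda>f. if smooth_near N (F p) f then v (\<lambda>q. f (F q)) else 0)"

text \<open>
  Vector fields on an open set \<open>W\<close> are extended by \<open>0\<close>, so that equality of vector fields is
  equality of functions.
\<close>

definition vector_field :: "('a, 'e::euclidean_space) atlas \<Rightarrow> 'a set \<Rightarrow> ('a \<Rightarrow> 'a tvec) \<Rightarrow> bool" where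
  "vector_field M W X \<longleftrightarrow> open_set M W \<and>
     (\<forall>p\<in>W. X p \<in> tangent_space M p) \<and> (\<forall>p. p \<notin> W \<longrightarrow> X p = 0) \<and>
     (\<forall>V f. V \<subseteq> W \<and> smooth_fun M V f \<longrightarrow> smooth_fun M V (\<lambda>p. X p f))"

abbreviation global_field :: "('a, 'e::euclidean_space) atlas \<Rightarrow> ('a \<Rightarrow> 'a tvec) \<Rightarrow> bool" where
  "global_field M \<equiv> vector_field M (carrier_of M)"

definition lie_bracket :: "('a, 'e::euclidean_space) atlas \<Rightarrow>
    ('a \<Rightarrow> 'a tvec) \<Rightarrow> ('a \<Rightarrow> 'a tvec) \<Rightarrow> 'a \<Rightarrow> 'a tvec" where
  "lie_bracket M X Y = (\<lambda>p f.
     if smooth_near M p f then X p (\<lambda>q. Y q f) - Y p (\<lambda>q. X q f) else 0)"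

text \<open>\<open>\<partial>/\<partial>x\<^sub>i\<close> at \<open>p \<in> U\<close>, as the velocity of the \<open>i\<close>-th coordinate line.\<close>

definition coord_field :: "('a, real^'n) atlas \<Rightarrow> 'a set \<Rightarrow> ('a \<Rightarrow> real^'n) \<Rightarrow> 'n \<Rightarrow> 'a \<Rightarrow> 'a tvec" where
  "coord_field M U x i p = velocity M (\<lambda>t. inv_into U x (x p + t *\<^sub>R axis i 1))"


section \<open>Metrics and connections\<close>

type_synonym 'a tensor2 = "'a \<Rightarrow> 'a tvec \<Rightarrow> 'a tvec \<Rightarrow> real"
type_synonym 'a connection = "('a \<Rightarrow> 'a tvec) \<Rightarrow> ('a \<Rightarrow> 'a tvec) \<Rightarrow> 'a \<Rightarrow> 'a tvec"

definition riemannian_metric :: "('a, 'e::euclidean_space) atlas \<Rightarrow> 'a tensor2 \<Rightarrow> bool" where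
  "riemannian_metric M h \<longleftrightarrow>
     (\<forall>p\<in>carrier_of M.
        (\<forall>u\<in>tangent_space M p. \<forall>v\<in>tangent_space M p. h p u v = h p v u) \<and>
        (\<forall>u\<in>tangent_space M p. \<forall>v\<in>tangent_space M p. \<forall>w\<in>tangent_space M p. \<forall>a b.
           h p (a \<cdot> u + b \<cdot> v) w = a * h p u w + b * h p v w) \<and>
        (\<forall>v\<in>tangent_space M p. v \<noteq> 0 \<longrightarrow> h p v v > 0)) \<and>
     (\<forall>W X Y. vector_field M W X \<and> vector_field M W Y \<longrightarrow>
        smooth_fun M W (\<lambda>p. h p (X p) (Y p)))"

definition affine_connection :: "('a, 'e::euclidean_space) atlas \<Rightarrow> 'a connection \<Rightarrow> bool" where
  "affine_connection M nabla \<longleftrightarrow>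
     (\<forall>X Y. global_field M X \<and> global_field M Y \<longrightarrow> global_field M (nabla X Y)) \<and>
     (\<forall>X X' Y f f'. global_field M X \<and> global_field M X' \<and> global_field M Y \<and>
        smooth_fun M (carrier_of M) f \<and> smooth_fun M (carrier_of M) f' \<longrightarrow>
        nabla (\<lambda>p. f p \<cdot> X p + f' p \<cdot> X' p) Y = (\<lambda>p. f p \<cdot> nabla X Y p + f' p \<cdot> nabla X' Y p)) \<and>
     (\<forall>X Y Y'. global_field M X \<and> global_field M Y \<and> global_field M Y' \<longrightarrow>
        nabla X (Y + Y') = nabla X Y + nabla X Y') \<and>
     (\<forall>X Y f. global_field M X \<and> global_field M Y \<and> smooth_fun M (carrier_of M) f \<longrightarrow>
        nabla X (\<lambda>p. f p \<cdot> Y p) = (\<lambda>p. X p f \<cdot> Y p + f p \<cdot> nabla X Y p))"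

definition torsion_free :: "('a, 'e::euclidean_space) atlas \<Rightarrow> 'a connection \<Rightarrow> bool" where
  "torsion_free M nabla \<longleftrightarrow> (\<forall>X Y. global_field M X \<and> global_field M Y \<longrightarrow>
     nabla X Y - nabla Y X - lie_bracket M X Y = 0)"

definition curvature_free :: "('a, 'e::euclidean_space) atlas \<Rightarrow> 'a connection \<Rightarrow> bool" where
  "curvature_free M nabla \<longleftrightarrow>
     (\<forall>X Y Z. global_field M X \<and> global_field M Y \<and> global_field M Z \<longrightarrow>
        nabla X (nabla Y Z) - nabla Y (nabla X Z) - nabla (lie_bracket M X Y) Z = 0)"

definition flat_connection :: "('a, 'e::euclidean_space) atlas \<Rightarrow> 'a connection \<Rightarrow> bool" where
  "flat_connection M nabla \<longleftrightarrow>
     affine_connection M nabla \<and> torsion_free M nabla \<and> curvature_free M nabla"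

definition dual_connections :: "('a, 'e::euclidean_space) atlas \<Rightarrow> 'a tensor2 \<Rightarrow>
    'a connection \<Rightarrow> 'a connection \<Rightarrow> bool" where
  "dual_connections M h nabla nabla' \<longleftrightarrow>
     (\<forall>X Y Z. global_field M X \<and> global_field M Y \<and> global_field M Z \<longrightarrow>
        (\<forall>p\<in>carrier_of M. X p (\<lambda>q. h q (Y q) (Z q)) =
           h p (nabla X Y p) (Z p) + h p (Y p) (nabla' X Z p)))"

definition dually_flat :: "('a, 'e::euclidean_space) atlas \<Rightarrow> 'a tensor2 \<Rightarrow>
    'a connection \<Rightarrow> 'a connection \<Rightarrow> bool" where
  "dually_flat M h nabla nabla' \<longleftrightarrow> riemannian_metric M h \<and>
     flat_connection M nabla \<and> flat_connection M nabla' \<and> dual_connections M h nabla nabla'"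

text \<open>
  A connection is an operator on global vector fields. Its value at \<open>p\<close> depends only on the
  germs of its arguments at \<open>p\<close>, which extends it to vector fields defined near \<open>p\<close>.
\<close>

definition local_nabla :: "('a, 'e::euclidean_space) atlas \<Rightarrow> 'a connection \<Rightarrow> 'a connection" where
  "local_nabla M nabla X Y p = (THE v. \<exists>X' Y' W.
     global_field M X' \<and> global_field M Y' \<and> open_set M W \<and> p \<in> W \<and>
     (\<forall>q\<in>W. X' q = X q \<and> Y' q = Y q) \<and> v = nabla X' Y' p)"

definition christoffel :: "('a, real^'n) atlas \<Rightarrow> 'a connection \<Rightarrow> 'a set \<Rightarrow> ('a \<Rightarrow> real^'n) \<Rightarrow>
    'n \<Rightarrow> 'n \<Rightarrow> 'n \<Rightarrow> 'a \<Rightarrow> real" where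
  "christoffel M nabla U x i j k p =
     local_nabla M nabla (coord_field M U x i) (coord_field M U x j) p (\<lambda>q. x q $ k)"

definition affine_coordinates :: "('a, real^'n) atlas \<Rightarrow> 'a connection \<Rightarrow>
    'a set \<Rightarrow> ('a \<Rightarrow> real^'n) \<Rightarrow> bool" where
  "affine_coordinates M nabla U x \<longleftrightarrow> coordinate_system M U x \<and>
     (\<forall>i j k. \<forall>p\<in>U. christoffel M nabla U x i j k p = 0)"


section \<open>Dombrowski's construction\<close>

text \<open>
  The connector \<open>K : T(TM) \<rightarrow> TM\<close> maps \<open>T\<^sub>u(TM)\<close> linearly to \<open>T\<^sub>p M\<close>, where \<open>u \<in> T\<^sub>p M\<close>, and
  satisfies \<open>\<nabla>\<^sub>X Y = K Y\<^sub>* X\<close>. Linearity on fibres is needed for uniqueness, because vertical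
  vectors are not of the form \<open>Y\<^sub>* X\<close>. We write \<open>K u A\<close> for \<open>K A\<close> with \<open>A \<in> T\<^sub>u(TM)\<close>.
\<close>

definition connector :: "('a, 'e::euclidean_space) atlas \<Rightarrow> 'a connection \<Rightarrow>
    ('a tpoint \<Rightarrow> 'a tpoint tvec \<Rightarrow> 'a tvec) \<Rightarrow> bool" where
  "connector M nabla K \<longleftrightarrow>
     (\<forall>u\<in>carrier_of (tangent_bundle M).
        (\<forall>A\<in>tangent_space (tangent_bundle M) u. K u A \<in> tangent_space M (fst u)) \<and>
        (\<forall>A\<in>tangent_space (tangent_bundle M) u. \<forall>B\<in>tangent_space (tangent_bundle M) u. \<forall>a b.
           K u (a \<cdot> A + b \<cdot> B) = a \<cdot> K u A + b \<cdot> K u B)) \<and>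
     (\<forall>X Y. global_field M X \<and> global_field M Y \<longrightarrow> (\<forall>p\<in>carrier_of M.
        nabla X Y p =
          K (p, Y p) (push_forward M (tangent_bundle M) (\<lambda>q. (q, Y q)) p (X p))))"

definition d_pi :: "('a, 'e::euclidean_space) atlas \<Rightarrow> 'a tpoint \<Rightarrow> 'a tpoint tvec \<Rightarrow> 'a tvec" where
  "d_pi M u A = push_forward (tangent_bundle M) M fst u A"

definition dombrowski_g :: "('a, 'e::euclidean_space) atlas \<Rightarrow> 'a tensor2 \<Rightarrow>
    ('a tpoint \<Rightarrow> 'a tpoint tvec \<Rightarrow> 'a tvec) \<Rightarrow> 'a tpoint tensor2" where
  "dombrowski_g M h K u A B =
     h (fst u) (d_pi M u A) (d_pi M u B) + h (fst u) (K u A) (K u B)"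

text \<open>
  \<open>J(u, v, w) = (u, -w, v)\<close> under the identification of \<open>A \<in> T\<^sub>u(TM)\<close> with \<open>(u, \<pi>\<^sub>* A, K A)\<close>.
\<close>

definition dombrowski_J :: "('a, 'e::euclidean_space) atlas \<Rightarrow>
    ('a tpoint \<Rightarrow> 'a tpoint tvec \<Rightarrow> 'a tvec) \<Rightarrow> 'a tpoint \<Rightarrow> 'a tpoint tvec \<Rightarrow> 'a tpoint tvec" where
  "dombrowski_J M K u A = (THE B. B \<in> tangent_space (tangent_bundle M) u \<and>
     d_pi M u B = - K u A \<and> K u B = d_pi M u A)"

definition dombrowski_omega :: "('a, 'e::euclidean_space) atlas \<Rightarrow> 'a tensor2 \<Rightarrow>
    ('a tpoint \<Rightarrow> 'a tpoint tvec \<Rightarrow> 'a tvec) \<Rightarrow> 'a tpoint tensor2" where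
  "dombrowski_omega M h K u A B = dombrowski_g M h K u (dombrowski_J M K u A) B"


section \<open>Kaehler functions\<close>

definition hamiltonian_field :: "('a, 'e::euclidean_space) atlas \<Rightarrow> 'a set \<Rightarrow> 'a tensor2 \<Rightarrow>
    ('a \<Rightarrow> real) \<Rightarrow> ('a \<Rightarrow> 'a tvec) \<Rightarrow> bool" where
  "hamiltonian_field N W \<omega> f X \<longleftrightarrow> vector_field N W X \<and>
     (\<forall>p\<in>W. \<forall>v\<in>tangent_space N p. \<omega> p (X p) v = v f)"

definition lie_derivative2 :: "('a, 'e::euclidean_space) atlas \<Rightarrow> ('a \<Rightarrow> 'a tvec) \<Rightarrow> 'a tensor2 \<Rightarrow>
    ('a \<Rightarrow> 'a tvec) \<Rightarrow> ('a \<Rightarrow> 'a tvec) \<Rightarrow> 'a \<Rightarrow> real" where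
  "lie_derivative2 N X g Y Z p = X p (\<lambda>q. g q (Y q) (Z q))
     - g p (lie_bracket N X Y p) (Z p) - g p (Y p) (lie_bracket N X Z p)"

text \<open>
  \<open>f\<close> is a Kaehler function on the open submanifold \<open>W\<close> of the Kaehler manifold \<open>(N, g, \<omega>)\<close>.
  Since \<open>\<omega>\<close> is nondegenerate, the Hamiltonian vector field exists and is unique.
\<close>

definition kaehler_function :: "('a, 'e::euclidean_space) atlas \<Rightarrow> 'a tensor2 \<Rightarrow> 'a tensor2 \<Rightarrow>
    'a set \<Rightarrow> ('a \<Rightarrow> real) \<Rightarrow> bool" where
  "kaehler_function N g \<omega> W f \<longleftrightarrow> smooth_fun N W f \<and>
     (\<exists>X. hamiltonian_field N W \<omega> f X \<and>
        (\<forall>Y Z. vector_field N W Y \<and> vector_field N W Z \<longrightarrow>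
           (\<forall>p\<in>W. lie_derivative2 N X g Y Z p = 0)))"

end

theory Submission
  imports Defs
begin

text \<open>
  An affine coordinate system \<open>x\<close> of \<open>\<nabla>\<close> induces coordinates \<open>(x, \<xi>)\<close> on \<open>TM\<close>. Since the Christoffel
  symbols vanish, the connector reads \<open>K (a, b) = b\<close> there, hence \<open>g = h(x)(d x, d x) + h(x)(d \<xi>, d \<xi>)\<close>
  and \<open>J (a, b) = (- b, a)\<close>. Duality of the coordinates means \<open>d y\<^sub>i = h (\<partial>/\<partial>x\<^sub>i, \<cdot>)\<close>, so the Hamiltonian
  field of \<open>y\<^sub>i \<circ> \<pi>\<close> is the vertical field \<open>- \<partial>/\<partial>\<xi>\<^sub>i\<close>, and it is Killing because the coefficients of \<open>g\<close>
  do not depend on \<open>\<xi>\<close>. Bump functions enter because a connection acts on global fields only.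
\<close>

section \<open>Calculus of smooth maps\<close>

text \<open>The connector is known only through the values \<open>nabla X Y p\<close> on
  push-forwards of vectors along global sections, while \<open>g\<close> and \<open>J\<close> need
  it on all of the tangent space of the bundle, and nonzero vertical vectors are never such
  push-forwards. A global section with prescribed value and first derivative at p determines
  \<open>K\<close> on vectors (e_i, b): in the coordinate frame the Leibniz rule reduces to
  differentiating components. Linearity on fibres does the rest, a vertical vector being the
  difference of two vectors with equal base part. The Killing property is verified without flows.
  The bracket of a field with constant components with a field Y is the derivative of the components
  of Y, since second derivatives cancel by symmetry; the product rule along a fibre then produces
  exactly the two terms that the Lie derivative subtracts. Tangent vectors are operators with value
  0 on functions that are not smooth near the point. Identities between vectors are therefore
  checked on smooth germs, and smoothness has to be carried through every pull-back.\<close>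

lemma Ck_on_has_derivative:
  assumes "Ck_on (Suc k) f S" "x \<in> S"
  shows "(f has_derivative frechet_derivative f (at x)) (at x)"
  using assms by (auto simp: frechet_derivative_works)

lemma Ck_on_cong:
  assumes "open S" "\<And>x. x \<in> S \<Longrightarrow> f x = g x" "Ck_on k f S"
  shows "Ck_on k g S"
  using assms
proof (induction k arbitrary: f g)
  case 0
  then show ?case by (auto cong: continuous_on_cong)
next
  case (Suc k)
  have der: "(g has_derivative frechet_derivative f (at x)) (at x)" if "x \<in> S" for x
    using has_derivative_transform_within_open[OF Ck_on_has_derivative[OF Suc.prems(3) that] Suc.prems(1) that]
      Suc.prems(2) by blast
  then have eq: "frechet_derivative g (at x) = frechet_derivative f (at x)" if "x \<in> S" for x
    using frechet_derivative_at that by metis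
  have "Ck_on k (\<lambda>x. frechet_derivative g (at x) b) S" if "b \<in> Basis" for b
    by (rule Suc.IH[of "\<lambda>x. frechet_derivative f (at x) b"]) (use Suc.prems that eq in auto)
  with der show ?case
    by (auto simp: differentiable_def)
qed

text \<open>Lets any family \<open>f'\<close> of derivatives stand in for
  \<open>frechet_derivative\<close>, so that closure under an operation follows by induction on
  \<open>k\<close> from its differentiation rule. Openness of \<open>S\<close> lets this exchange
  persist in the higher derivatives.\<close>

lemma Ck_on_SucI:
  assumes "open S" "\<And>x. x \<in> S \<Longrightarrow> (f has_derivative f' x) (at x)"
    and "\<And>b. b \<in> Basis \<Longrightarrow> Ck_on k (\<lambda>x. f' x b) S"
  shows "Ck_on (Suc k) f S"
proof -
  have eq: "frechet_derivative f (at x) = f' x" if "x \<in> S" for x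
    using frechet_derivative_at assms(2) that by metis
  have "Ck_on k (\<lambda>x. frechet_derivative f (at x) b) S" if "b \<in> Basis" for b
    by (rule Ck_on_cong[of _ "\<lambda>x. f' x b"]) (use assms that eq in auto)
  then show ?thesis
    using assms(2) by (auto simp: differentiable_def)
qed

lemma Ck_on_SucD: "Ck_on (Suc k) f S \<Longrightarrow> Ck_on k f S"
proof (induction k arbitrary: f)
  case 0
  then show ?case
    by (simp add: continuous_at_imp_continuous_on differentiable_imp_continuous_within)
next
  case (Suc k)
  then show ?case by (metis Ck_on.simps(2))
qed

lemma Ck_on_subset: "Ck_on k f S \<Longrightarrow> T \<subseteq> S \<Longrightarrow> Ck_on k f T"
  by (induction k arbitrary: f) (auto intro: continuous_on_subset)

lemma Ck_on_local:
  assumes "\<And>x. x \<in> S \<Longrightarrow> \<exists>T. open T \<and> x \<in> T \<and> Ck_on k f T"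
  shows "Ck_on k f S"
  using assms
proof (induction k arbitrary: f)
  case 0
  then show ?case
    by (metis Ck_on.simps(1) continuous_at_imp_continuous_on continuous_on_eq_continuous_at)
next
  case (Suc k)
  have "f differentiable (at x)" if "x \<in> S" for x
    using Suc.prems[OF that] by auto
  moreover have "Ck_on k (\<lambda>x. frechet_derivative f (at x) b) S" if "b \<in> Basis" for b
    by (rule Suc.IH) (use Suc.prems that in fastforce)
  ultimately show ?case by auto
qed

lemma Ck_on_const: "Ck_on k (\<lambda>x. c) S"
  by (induction k arbitrary: c) auto

lemma Ck_on_bounded_linear:
  assumes "open S" "bounded_linear L"
  shows "Ck_on k L S"
proof (cases k)
  case 0
  then show ?thesis using assms by (auto intro: linear_continuous_on)
next
  case (Suc j)
  show ?thesis unfolding Suc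
    by (rule Ck_on_SucI[where f' = "\<lambda>x. L"])
      (use assms in \<open>auto intro: bounded_linear_imp_has_derivative Ck_on_const\<close>)
qed

lemma Ck_on_bounded_linear_image:
  assumes "open S" "bounded_linear L" "Ck_on k f S"
  shows "Ck_on k (\<lambda>x. L (f x)) S"
  using assms(3)
proof (induction k arbitrary: f)
  case 0
  then show ?case using assms
    by (auto intro: bounded_linear.continuous_on)
next
  case (Suc k)
  show ?case
    by (rule Ck_on_SucI[where f' = "\<lambda>x b. L (frechet_derivative f (at x) b)"])
      (use assms Suc.IH Suc.prems in \<open>auto intro!: bounded_linear.has_derivative[OF assms(2)] simp: frechet_derivative_works\<close>)
qed

lemma Ck_on_add:
  assumes "open S" "Ck_on k f S" "Ck_on k g S"
  shows "Ck_on k (\<lambda>x. f x + g x) S"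
  using assms(2,3)
proof (induction k arbitrary: f g)
  case 0
  then show ?case by (auto intro: continuous_intros)
next
  case (Suc k)
  show ?case
    by (rule Ck_on_SucI[where f' = "\<lambda>x b. frechet_derivative f (at x) b + frechet_derivative g (at x) b"])
      (use assms Suc.IH Suc.prems in \<open>auto intro!: has_derivative_add simp: frechet_derivative_works\<close>)
qed

lemma Ck_on_sum:
  assumes "open S" "\<And>i. i \<in> I \<Longrightarrow> Ck_on k (f i) S"
  shows "Ck_on k (\<lambda>x. \<Sum>i\<in>I. f i x) S"
  using assms(2) by (induction I rule: infinite_finite_induct) (auto intro: Ck_on_const Ck_on_add assms)

text \<open>The Leibniz rule gives two products of order \<open>k\<close>, each with one
  undifferentiated factor, whose order is lowered by \<open>Ck_on_SucD\<close>. Products, scalar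
  multiples and inner products are all instances.\<close>

lemma Ck_on_bilinear:
  fixes f :: "'e::euclidean_space \<Rightarrow> 'f::real_normed_vector"
  assumes "bounded_bilinear P" "open S" "Ck_on k f S" "Ck_on k g S"
  shows "Ck_on k (\<lambda>x. P (f x) (g x)) S"
  using assms(3,4)
proof (induction k arbitrary: f g)
  case 0
  then show ?case using assms by (auto intro: bounded_bilinear.continuous_on)
next
  case (Suc k)
  show ?case
  proof (rule Ck_on_SucI[where f' = "\<lambda>x b. P (f x) (frechet_derivative g (at x) b) + P (frechet_derivative f (at x) b) (g x)"])
    fix x assume "x \<in> S"
    then show "((\<lambda>x. P (f x) (g x)) has_derivative
         (\<lambda>b. P (f x) (frechet_derivative g (at x) b) + P (frechet_derivative f (at x) b) (g x))) (at x)"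
      by (intro bounded_bilinear.FDERIV[OF assms(1)] Ck_on_has_derivative[OF Suc.prems(1)]
          Ck_on_has_derivative[OF Suc.prems(2)])
  next
    fix b :: 'e assume "b \<in> Basis"
    then show "Ck_on k (\<lambda>x. P (f x) (frechet_derivative g (at x) b) + P (frechet_derivative f (at x) b) (g x)) S"
      using Suc.prems Ck_on_SucD by (intro Ck_on_add Suc.IH assms) (auto intro: Ck_on_SucD)
  qed (rule assms)
qed

lemma frechet_derivative_euclidean:
  fixes f :: "'e::euclidean_space \<Rightarrow> 'f::real_normed_vector"
  assumes "f differentiable (at x)"
  shows "frechet_derivative f (at x) v = (\<Sum>b\<in>Basis. (v \<bullet> b) *\<^sub>R frechet_derivative f (at x) b)"
proof -
  have "linear (frechet_derivative f (at x))" using assms by (rule linear_frechet_derivative)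
  from linear_sum[OF this, of "\<lambda>b. (v \<bullet> b) *\<^sub>R b" Basis] show ?thesis
    by (simp add: euclidean_representation linear_cmul[OF \<open>linear _\<close>])
qed

text \<open>Expanding the chain rule in the basis writes the derivative as a finite sum of
  components of the derivative of \<open>f\<close> times partial derivatives of \<open>g\<close>
  composed with \<open>f\<close>. The induction hypothesis, with \<open>g\<close> arbitrary, covers
  these compositions.\<close>

lemma Ck_on_compose:
  fixes f :: "'e::euclidean_space \<Rightarrow> 'f::euclidean_space" and g :: "'f \<Rightarrow> 'g::real_normed_vector"
  assumes "open S" "Ck_on k f S" "Ck_on k g T" "f ` S \<subseteq> T"
  shows "Ck_on k (\<lambda>x. g (f x)) S"
  using assms(2,3)
proof (induction k arbitrary: g)
  case 0
  then show ?case using assms by (auto intro: continuous_on_compose2)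
next
  case (Suc k)
  let ?g = "\<lambda>x. frechet_derivative g (at x)"
  show ?case
  proof (rule Ck_on_SucI[where f' = "\<lambda>x b. \<Sum>c\<in>Basis. (frechet_derivative f (at x) b \<bullet> c) *\<^sub>R ?g (f x) c"])
    fix x assume x: "x \<in> S"
    then have "f x \<in> T" using assms by auto
    then have gd: "(g has_derivative ?g (f x)) (at (f x))" by (rule Ck_on_has_derivative[OF Suc.prems(2)])
    have "((\<lambda>x. g (f x)) has_derivative (\<lambda>b. ?g (f x) (frechet_derivative f (at x) b))) (at x)"
      by (rule has_derivative_compose[OF Ck_on_has_derivative[OF Suc.prems(1) x] gd])
    moreover have "(\<lambda>b. ?g (f x) (frechet_derivative f (at x) b))
        = (\<lambda>b. \<Sum>c\<in>Basis. (frechet_derivative f (at x) b \<bullet> c) *\<^sub>R ?g (f x) c)"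
      using gd by (intro ext frechet_derivative_euclidean) (auto simp: differentiable_def)
    ultimately show "((\<lambda>x. g (f x)) has_derivative
        (\<lambda>b. \<Sum>c\<in>Basis. (frechet_derivative f (at x) b \<bullet> c) *\<^sub>R ?g (f x) c)) (at x)" by simp
  next
    fix b :: 'e assume b: "b \<in> Basis"
    show "Ck_on k (\<lambda>x. \<Sum>c\<in>Basis. (frechet_derivative f (at x) b \<bullet> c) *\<^sub>R ?g (f x) c) S"
    proof (intro Ck_on_sum assms Ck_on_bilinear[OF bounded_bilinear_scaleR])
      fix c :: 'f assume c: "c \<in> Basis"
      show "Ck_on k (\<lambda>x. frechet_derivative f (at x) b \<bullet> c) S"
        using Suc.prems(1) b by (auto intro: Ck_on_bounded_linear_image[OF assms(1) bounded_linear_inner_left])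
      show "Ck_on k (\<lambda>x. ?g (f x) c) S"
        using Suc.prems c by (intro Suc.IH) (auto intro: Ck_on_SucD)
    qed
  qed (rule assms)
qed

lemma smooth_on_cong: "open S \<Longrightarrow> (\<And>x. x \<in> S \<Longrightarrow> f x = g x) \<Longrightarrow> smooth_on f S \<Longrightarrow> smooth_on g S"
  unfolding smooth_on_def using Ck_on_cong by blast

lemma smooth_on_subset: "smooth_on f S \<Longrightarrow> T \<subseteq> S \<Longrightarrow> smooth_on f T"
  unfolding smooth_on_def using Ck_on_subset by blast

lemma smooth_on_local:
  "(\<And>x. x \<in> S \<Longrightarrow> \<exists>T. open T \<and> x \<in> T \<and> smooth_on f T) \<Longrightarrow> smooth_on f S"
  unfolding smooth_on_def using Ck_on_local by (metis (no_types, lifting))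

lemma smooth_on_const: "smooth_on (\<lambda>x. c) S"
  unfolding smooth_on_def by (simp add: Ck_on_const)

lemma smooth_on_bounded_linear: "open S \<Longrightarrow> bounded_linear L \<Longrightarrow> smooth_on L S"
  unfolding smooth_on_def by (simp add: Ck_on_bounded_linear)

lemma smooth_on_bounded_linear_image:
  "open S \<Longrightarrow> bounded_linear L \<Longrightarrow> smooth_on f S \<Longrightarrow> smooth_on (\<lambda>x. L (f x)) S"
  unfolding smooth_on_def by (simp add: Ck_on_bounded_linear_image)

lemma smooth_on_add: "open S \<Longrightarrow> smooth_on f S \<Longrightarrow> smooth_on g S \<Longrightarrow> smooth_on (\<lambda>x. f x + g x) S"
  unfolding smooth_on_def by (simp add: Ck_on_add)

lemma smooth_on_sum: "open S \<Longrightarrow> (\<And>i. i \<in> I \<Longrightarrow> smooth_on (f i) S) \<Longrightarrow> smooth_on (\<lambda>x. \<Sum>i\<in>I. f i x) S"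
  unfolding smooth_on_def by (simp add: Ck_on_sum)

lemma smooth_on_bilinear:
  "bounded_bilinear P \<Longrightarrow> open S \<Longrightarrow> smooth_on f S \<Longrightarrow> smooth_on g S \<Longrightarrow> smooth_on (\<lambda>x. P (f x) (g x)) S"
  unfolding smooth_on_def by (simp add: Ck_on_bilinear)

lemmas smooth_on_mult = smooth_on_bilinear[OF bounded_bilinear_mult]
lemmas smooth_on_scaleR = smooth_on_bilinear[OF bounded_bilinear_scaleR]
lemmas smooth_on_inner = smooth_on_bounded_linear_image[OF _ bounded_linear_inner_left]

lemma smooth_on_compose:
  fixes f :: "'e::euclidean_space \<Rightarrow> 'f::euclidean_space" and g :: "'f \<Rightarrow> 'g::real_normed_vector"
  shows "open S \<Longrightarrow> smooth_on f S \<Longrightarrow> smooth_on g T \<Longrightarrow> f ` S \<subseteq> T \<Longrightarrow> smooth_on (\<lambda>x. g (f x)) S"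
  unfolding smooth_on_def by (metis Ck_on_compose)

lemma smooth_on_Pair:
  fixes f :: "'e::euclidean_space \<Rightarrow> 'f::euclidean_space" and g :: "'e \<Rightarrow> 'g::euclidean_space"
  assumes "open S" "smooth_on f S" "smooth_on g S"
  shows "smooth_on (\<lambda>x. (f x, g x)) S"
proof -
  have "smooth_on (\<lambda>x. (f x, 0) + (0, g x)) S"
    using assms by (intro smooth_on_add smooth_on_bounded_linear_image[of _ "\<lambda>y. (y, 0)"]
        smooth_on_bounded_linear_image[of _ "\<lambda>y. (0, y)"])
      (auto intro!: bounded_linear_Pair bounded_linear_zero bounded_linear_ident)
  then show ?thesis by simp
qed

lemma smooth_on_differentiable: "smooth_on f S \<Longrightarrow> x \<in> S \<Longrightarrow> f differentiable (at x)"
  unfolding smooth_on_def by (metis Ck_on.simps(2))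

lemma smooth_on_has_derivative:
  "smooth_on f S \<Longrightarrow> x \<in> S \<Longrightarrow> (f has_derivative frechet_derivative f (at x)) (at x)"
  using smooth_on_differentiable frechet_derivative_works by blast

lemma smooth_on_imp_continuous_on: "smooth_on f S \<Longrightarrow> continuous_on S f"
  unfolding smooth_on_def by (metis Ck_on.simps(1))

lemma smooth_on_derivative:
  assumes "open S" "smooth_on f S"
  shows "smooth_on (\<lambda>x. frechet_derivative f (at x) v) S"
proof -
  have "smooth_on (\<lambda>x. frechet_derivative f (at x) b) S" if "b \<in> Basis" for b
    using assms(2) that unfolding smooth_on_def by (metis Ck_on.simps(2))
  then have "smooth_on (\<lambda>x. \<Sum>b\<in>Basis. (v \<bullet> b) *\<^sub>R frechet_derivative f (at x) b) S"
    using assms by (intro smooth_on_sum smooth_on_scaleR smooth_on_const)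
  then show ?thesis
    by (rule smooth_on_cong[rotated 2])
      (use assms in \<open>auto simp: frechet_derivative_euclidean[OF smooth_on_differentiable, symmetric]\<close>)
qed

text \<open>The derivative is linear in the direction, hence a finite sum of coordinates of
  \<open>v\<close> times partial derivatives. The map serves as the fibre part of the transition
  maps of the tangent bundle, and to show that a field with smooth components takes smooth functions
  to smooth ones.\<close>

lemma smooth_on_tangent_map:
  assumes "open S" "smooth_on f S"
  shows "smooth_on (\<lambda>(x, v). frechet_derivative f (at x) v) (S \<times> UNIV)"
proof -
  have o: "open (S \<times> (UNIV :: 'a set))" using assms by (simp add: open_Times)
  have "smooth_on (\<lambda>z::'a\<times>'a. \<Sum>b\<in>Basis. (snd z \<bullet> b) *\<^sub>R frechet_derivative f (at (fst z)) b) (S \<times> UNIV)"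
    using o by (intro smooth_on_sum smooth_on_scaleR smooth_on_inner smooth_on_bounded_linear
        bounded_linear_snd smooth_on_compose[of _ fst "\<lambda>x. frechet_derivative f (at x) _" S]
        bounded_linear_fst smooth_on_derivative assms) auto
  then show ?thesis
    by (rule smooth_on_cong[rotated 2])
      (use assms o in \<open>auto simp: frechet_derivative_euclidean[OF smooth_on_differentiable, symmetric]\<close>)
qed

section \<open>Derivatives along lines and the symmetry of second derivatives\<close>

lemma has_real_derivative_line:
  fixes f :: "'e::real_normed_vector \<Rightarrow> real"
  assumes "f differentiable (at (y + s *\<^sub>R a))"
  shows "((\<lambda>s. f (y + s *\<^sub>R a)) has_real_derivative frechet_derivative f (at (y + s *\<^sub>R a)) a) (at s)"
proof -
  let ?D = "frechet_derivative f (at (y + s *\<^sub>R a))"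
  have D: "(f has_derivative ?D) (at (y + s *\<^sub>R a))" using assms by (simp add: frechet_derivative_works)
  have "((\<lambda>s. y + s *\<^sub>R a) has_derivative (\<lambda>h. h *\<^sub>R a)) (at s)"
    by (auto intro!: derivative_eq_intros)
  from has_derivative_compose[OF this D]
  have "((\<lambda>s. f (y + s *\<^sub>R a)) has_derivative (\<lambda>h. ?D (h *\<^sub>R a))) (at s)" .
  moreover have "(\<lambda>h. ?D (h *\<^sub>R a)) = (*) (?D a)"
    using linear_cmul[OF linear_frechet_derivative[OF assms]] by auto
  ultimately show ?thesis by (simp add: has_field_derivative_def)
qed

text \<open>The mean value theorem is applied twice: to the increment along \<open>b\<close> as a
  function of the step along \<open>a\<close>, then to the derivative along \<open>a\<close> as a
  function of the step along \<open>b\<close>.\<close>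

lemma second_difference_mean_value:
  fixes f :: "'e::euclidean_space \<Rightarrow> real"
  assumes f: "smooth_on f S" and S: "open S" and t: "t > 0"
    and sub: "\<And>s r. 0 \<le> s \<Longrightarrow> s \<le> t \<Longrightarrow> 0 \<le> r \<Longrightarrow> r \<le> t \<Longrightarrow> x + s *\<^sub>R a + r *\<^sub>R b \<in> S"
  shows "\<exists>s r. 0 < s \<and> s < t \<and> 0 < r \<and> r < t \<and>
    f (x + t *\<^sub>R a + t *\<^sub>R b) - f (x + t *\<^sub>R a) - f (x + t *\<^sub>R b) + f x =
      t * t * frechet_derivative (\<lambda>y. frechet_derivative f (at y) a) (at (x + s *\<^sub>R a + r *\<^sub>R b)) b"
proof -
  let ?D = "\<lambda>y. frechet_derivative f (at y) a"
  define g where "g s = f ((x + t *\<^sub>R b) + s *\<^sub>R a) - f (x + s *\<^sub>R a)" for s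
  have "(g has_real_derivative (?D ((x + t *\<^sub>R b) + s *\<^sub>R a) - ?D (x + s *\<^sub>R a))) (at s)"
    if "0 \<le> s" "s \<le> t" for s
    unfolding g_def using sub[OF that, of t] sub[OF that, of 0] t
    by (intro DERIV_diff has_real_derivative_line smooth_on_differentiable[OF f]) (auto simp: add_ac)
  from MVT2[OF t this] obtain s where s: "0 < s" "s < t"
    and gs: "g t - g 0 = t * (?D ((x + t *\<^sub>R b) + s *\<^sub>R a) - ?D (x + s *\<^sub>R a))" by auto
  have "((\<lambda>r. ?D ((x + s *\<^sub>R a) + r *\<^sub>R b)) has_real_derivative
      frechet_derivative ?D (at ((x + s *\<^sub>R a) + r *\<^sub>R b)) b) (at r)" if "0 \<le> r" "r \<le> t" for r
    using sub[of s r] that s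
    by (intro has_real_derivative_line smooth_on_differentiable[OF smooth_on_derivative[OF S f]]) auto
  from MVT2[OF t this] obtain r where r: "0 < r" "r < t"
    and Dr: "?D ((x + s *\<^sub>R a) + t *\<^sub>R b) - ?D (x + s *\<^sub>R a)
      = t * frechet_derivative ?D (at ((x + s *\<^sub>R a) + r *\<^sub>R b)) b" by auto
  have "g t - g 0 = t * (t * frechet_derivative ?D (at ((x + s *\<^sub>R a) + r *\<^sub>R b)) b)"
    using gs Dr by (simp add: add_ac)
  then show ?thesis
    using s r by (intro exI[of _ s] exI[of _ r]) (simp add: g_def algebra_simps)
qed

text \<open>The second difference is unchanged when \<open>a\<close> and \<open>b\<close> are
  exchanged, so the two mixed derivatives take a common value at points arbitrarily near
  \<open>x\<close>; their continuity forces equality at \<open>x\<close>.\<close>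

lemma symmetric_second_derivative:
  fixes f :: "'e::euclidean_space \<Rightarrow> real"
  assumes f: "smooth_on f S" and S: "open S" "x \<in> S"
  shows "frechet_derivative (\<lambda>y. frechet_derivative f (at y) a) (at x) b =
         frechet_derivative (\<lambda>y. frechet_derivative f (at y) b) (at x) a"
proof (rule ccontr)
  let ?H = "\<lambda>a b y. frechet_derivative (\<lambda>y. frechet_derivative f (at y) a) (at y) b"
  assume ne: "?H a b x \<noteq> ?H b a x"
  \<comment> \<open>Half of the supposed gap: values within \<open>e\<close> of the two sides cannot
    coincide.\<close>
  define e where "e = \<bar>?H a b x - ?H b a x\<bar> / 2"
  have e: "e > 0" using ne by (simp add: e_def)
  have "\<exists>d>0. \<forall>y. dist y x < d \<longrightarrow> y \<in> S \<and> dist (?H a b y) (?H a b x) < e" for a b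
  proof -
    have "continuous_on S (?H a b)"
      by (intro smooth_on_imp_continuous_on smooth_on_derivative S f)
    then have "isCont (?H a b) x" using S by (simp add: continuous_on_eq_continuous_at)
    then obtain d where "d > 0" "\<forall>y. dist y x < d \<longrightarrow> dist (?H a b y) (?H a b x) < e"
      using e unfolding continuous_at_eps_delta by blast
    moreover obtain d' where "d' > 0" "ball x d' \<subseteq> S"
      using S open_contains_ball by blast
    ultimately show ?thesis
      by (intro exI[of _ "min d d'"]) (auto simp: subset_iff dist_commute)
  qed
  from this[of a b] this[of b a] obtain d where d: "d > 0" "\<And>y. dist y x < d \<Longrightarrow> y \<in> S"
    "\<And>y. dist y x < d \<Longrightarrow> dist (?H a b y) (?H a b x) < e"
    "\<And>y. dist y x < d \<Longrightarrow> dist (?H b a y) (?H b a x) < e"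
    by (metis min_less_iff_conj)
  \<comment> \<open>Scaled so that the parallelogram spanned by \<open>t *\<^sub>R a\<close> and
    \<open>t *\<^sub>R b\<close> at \<open>x\<close> stays within distance \<open>d\<close>; the
    summand \<open>1\<close> keeps the denominator positive when both vectors vanish.\<close>
  define t where "t = d / (norm a + norm b + 1)"
  have pos: "norm a + norm b + 1 > 0" by (simp add: add_nonneg_pos)
  have t: "t > 0" using d pos by (simp add: t_def)
  have tn: "t * (norm a + norm b) < d"
    using d(1) pos by (simp add: t_def field_simps)
  have near: "dist (x + s *\<^sub>R a + r *\<^sub>R b) x < d" if "0 \<le> s" "s \<le> t" "0 \<le> r" "r \<le> t" for s r
  proof -
    have "norm (s *\<^sub>R a + r *\<^sub>R b) \<le> s * norm a + r * norm b"
      using norm_triangle_ineq[of "s *\<^sub>R a" "r *\<^sub>R b"] that by simp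
    also have "\<dots> \<le> t * norm a + t * norm b"
      using that by (intro add_mono mult_right_mono) auto
    finally show ?thesis using tn by (simp add: dist_norm algebra_simps)
  qed
  have near': "dist (x + s *\<^sub>R b + r *\<^sub>R a) x < d" if "0 \<le> s" "s \<le> t" "0 \<le> r" "r \<le> t" for s r
    using near[of r s] that by (simp add: add_ac)
  obtain s r where 1: "0 < s" "s < t" "0 < r" "r < t"
    "f (x + t *\<^sub>R a + t *\<^sub>R b) - f (x + t *\<^sub>R a) - f (x + t *\<^sub>R b) + f x
      = t * t * ?H a b (x + s *\<^sub>R a + r *\<^sub>R b)"
    using second_difference_mean_value[OF f S(1) t, of x a b] near d(2) by auto
  obtain s' r' where 2: "0 < s'" "s' < t" "0 < r'" "r' < t"
    "f (x + t *\<^sub>R b + t *\<^sub>R a) - f (x + t *\<^sub>R b) - f (x + t *\<^sub>R a) + f x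
      = t * t * ?H b a (x + s' *\<^sub>R b + r' *\<^sub>R a)"
    using second_difference_mean_value[OF f S(1) t, of x b a] near' d(2) by auto
  have sw: "x + t *\<^sub>R b + t *\<^sub>R a = x + t *\<^sub>R a + t *\<^sub>R b" by simp
  have "t * t * ?H a b (x + s *\<^sub>R a + r *\<^sub>R b) = t * t * ?H b a (x + s' *\<^sub>R b + r' *\<^sub>R a)"
    using 1(5) 2(5) unfolding sw by linarith
  then have "?H a b (x + s *\<^sub>R a + r *\<^sub>R b) = ?H b a (x + s' *\<^sub>R b + r' *\<^sub>R a)"
    using t by simp
  moreover have "dist (?H a b (x + s *\<^sub>R a + r *\<^sub>R b)) (?H a b x) < e"
    using 1 by (intro d near) auto
  moreover have "dist (?H b a (x + s' *\<^sub>R b + r' *\<^sub>R a)) (?H b a x) < e"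
    using 2 by (intro d near') auto
  ultimately have "\<bar>?H a b x - ?H b a x\<bar> < 2 * e"
    by (simp add: dist_real_def)
  then show False by (simp add: e_def)
qed

subsection \<open>Bump functions\<close>

text \<open>Index \<open>0\<close> is the classical flat function exp(-1/t). The powers of 1/t are
  included because differentiation produces them: derivatives are linear combinations of members of
  the family, which makes the induction on the order of smoothness work for all \<open>m\<close> at
  once.\<close>

definition flat_exp :: "nat \<Rightarrow> real \<Rightarrow> real" where
  "flat_exp m t = (if t > 0 then inverse t ^ m * exp (- inverse t) else 0)"

lemma flat_exp_tendsto_0: "(flat_exp m \<longlongrightarrow> 0) (at 0)"
proof -
  have "((\<lambda>t::real. inverse t ^ m / exp (inverse t)) \<longlongrightarrow> 0) (at_right 0)"
    by (rule filterlim_compose[OF tendsto_power_div_exp_0 filterlim_inverse_at_top_right])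
  then have "(flat_exp m \<longlongrightarrow> 0) (at_right 0)"
    by (rule Lim_transform_eventually)
      (auto simp: eventually_at_filter flat_exp_def exp_minus divide_inverse)
  moreover have "(flat_exp m \<longlongrightarrow> 0) (at_left 0)"
    by (rule Lim_transform_eventually[OF tendsto_const])
      (auto simp: eventually_at_filter flat_exp_def)
  ultimately show ?thesis by (simp add: filterlim_at_split)
qed

lemma has_real_derivative_flat_exp:
  "(flat_exp m has_real_derivative flat_exp (m + 2) t - real m * flat_exp (m + 1) t) (at t)"
proof -
  consider "t > 0" | "t < 0" | "t = 0" by linarith
  then show ?thesis
  proof cases
    case 1
    have "((\<lambda>t. inverse t ^ m * exp (- inverse t)) has_real_derivative
        flat_exp (m + 2) t - real m * flat_exp (m + 1) t) (at t)"
      using 1 by (auto intro!: derivative_eq_intros simp: flat_exp_def power2_eq_square)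
         (cases m; simp add: algebra_simps)
    then show ?thesis
      by (rule has_field_derivative_transform_within_open[of _ _ _ "{0<..}"])
        (use 1 in \<open>auto simp: flat_exp_def\<close>)
  next
    case 2
    have "((\<lambda>t. 0) has_real_derivative flat_exp (m + 2) t - real m * flat_exp (m + 1) t) (at t)"
      using 2 by (auto simp: flat_exp_def)
    then show ?thesis
      by (rule has_field_derivative_transform_within_open[of _ _ _ "{..<0}"])
        (use 2 in \<open>auto simp: flat_exp_def\<close>)
  next
    case 3
    \<comment> \<open>At the gluing point the difference quotient is itself a member of the family,
      so its limit is already known.\<close>
    have "(\<lambda>h. (flat_exp m (0 + h) - flat_exp m 0) / h) = flat_exp (m + 1)"
      by (auto simp: flat_exp_def fun_eq_iff field_simps)
    then have "(flat_exp m has_real_derivative 0) (at 0)"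
      using flat_exp_tendsto_0[of "m + 1"] by (simp add: DERIV_def)
    then show ?thesis using 3 by (simp add: flat_exp_def)
  qed
qed

lemma smooth_on_flat_exp: "smooth_on (flat_exp m) UNIV"
proof -
  have "Ck_on k (flat_exp m) UNIV" for k
  proof (induction k arbitrary: m)
    case 0
    show ?case
      using DERIV_isCont[OF has_real_derivative_flat_exp] by (simp add: continuous_on_eq_continuous_at)
  next
    case (Suc k)
    show ?case
    proof (rule Ck_on_SucI[where f' = "\<lambda>t. (*) (flat_exp (m + 2) t - real m * flat_exp (m + 1) t)"])
      fix b :: real assume "b \<in> Basis"
      then have "b = 1" by simp
      have "Ck_on k (\<lambda>t. flat_exp (m + 2) t + (- real m) * flat_exp (m + 1) t) UNIV"
        by (intro Ck_on_add Ck_on_bilinear[OF bounded_bilinear_mult] Ck_on_const Suc.IH) auto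
      then show "Ck_on k (\<lambda>t. (flat_exp (m + 2) t - real m * flat_exp (m + 1) t) * b) UNIV"
        by (simp add: \<open>b = 1\<close>)
    qed (use has_real_derivative_flat_exp in \<open>auto simp: has_field_derivative_def\<close>)
  qed
  then show ?thesis by (simp add: smooth_on_def)
qed

lemma smooth_on_inverse: "smooth_on (inverse :: real \<Rightarrow> real) {0<..}"
proof -
  have "Ck_on k (inverse :: real \<Rightarrow> real) {0<..}" for k
  proof (induction k)
    case 0
    show ?case by (auto intro!: continuous_intros)
  next
    case (Suc k)
    show ?case
    proof (rule Ck_on_SucI[where f' = "\<lambda>t. (*) (- (inverse t * inverse t))"])
      fix b :: real assume "b \<in> Basis"
      then have "b = 1" by simp
      have "Ck_on k (\<lambda>t::real. (-1) * (inverse t * inverse t)) {0<..}"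
        by (intro Ck_on_bilinear[OF bounded_bilinear_mult] Ck_on_const Suc.IH) auto
      then show "Ck_on k (\<lambda>t::real. - (inverse t * inverse t) * b) {0<..}"
        by (simp add: \<open>b = 1\<close>)
    next
      fix t :: real assume "t \<in> {0<..}"
      then show "(inverse has_derivative (*) (- (inverse t * inverse t))) (at t)"
        using DERIV_inverse[of t UNIV] by (simp add: has_field_derivative_def power2_eq_square)
    qed auto
  qed
  then show ?thesis by (simp add: smooth_on_def)
qed

text \<open>The denominator is positive everywhere, because \<open>t\<close> or \<open>1 - t\<close>
  is positive.\<close>

definition smooth_step :: "real \<Rightarrow> real" where
  "smooth_step t = flat_exp 0 t * inverse (flat_exp 0 t + flat_exp 0 (1 - t))"

lemma smooth_step_eq_0: "t \<le> 0 \<Longrightarrow> smooth_step t = 0"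
  by (simp add: smooth_step_def flat_exp_def)

lemma smooth_step_eq_1: "t \<ge> 1 \<Longrightarrow> smooth_step t = 1"
  by (simp add: smooth_step_def flat_exp_def)

lemma smooth_on_smooth_step: "smooth_on smooth_step UNIV"
proof -
  have "smooth_on (\<lambda>t::real. 1 + (- t)) UNIV"
    by (intro smooth_on_add smooth_on_const smooth_on_bounded_linear bounded_linear_minus
        bounded_linear_ident) auto
  then have 1: "smooth_on (\<lambda>t. flat_exp 0 (1 + - t)) UNIV"
    by (rule smooth_on_compose[OF open_UNIV _ smooth_on_flat_exp]) auto
  have pos: "flat_exp 0 t + flat_exp 0 (1 + - t) > 0" for t
    by (simp add: flat_exp_def add_pos_pos)
  have "smooth_on (\<lambda>t. inverse (flat_exp 0 t + flat_exp 0 (1 + - t))) UNIV"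
    by (intro smooth_on_compose[OF _ _ smooth_on_inverse] smooth_on_add smooth_on_flat_exp 1)
      (use pos in auto)
  then have "smooth_on (\<lambda>t. flat_exp 0 t * inverse (flat_exp 0 t + flat_exp 0 (1 + - t))) UNIV"
    by (intro smooth_on_mult smooth_on_flat_exp) auto
  then show ?thesis by (simp add: smooth_step_def[abs_def])
qed

lemma smooth_bump:
  fixes z :: "'e::euclidean_space"
  assumes "r > 0"
  shows "\<exists>f::'e \<Rightarrow> real. smooth_on f UNIV \<and> (\<exists>d>0. \<forall>w. dist w z < d \<longrightarrow> f w = 1) \<and>
    (\<forall>w. dist w z \<ge> r \<longrightarrow> f w = 0)"
proof -
  \<comment> \<open>Made to be at least 1 up to distance \<open>r / 2\<close> and at most 0 from
    distance \<open>r\<close> on. The squared distance is an inner product here, so that smoothness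
    comes from the bilinear rule and no norm is differentiated.\<close>
  define q where "q w = 2 + (- (2 / r^2)) * ((w + (- z)) \<bullet> (w + (- z)))" for w
  have q: "q w = 2 - 2 * (dist w z)^2 / r^2" for w
    by (simp add: q_def dist_norm power2_norm_eq_inner)
  have "smooth_on q UNIV"
    unfolding q_def
    by (intro smooth_on_add smooth_on_const smooth_on_mult smooth_on_bilinear[OF bounded_bilinear_inner]
        smooth_on_bounded_linear bounded_linear_ident) auto
  then have "smooth_on (\<lambda>w. smooth_step (q w)) UNIV"
    by (rule smooth_on_compose[OF open_UNIV _ smooth_on_smooth_step]) auto
  moreover have "smooth_step (q w) = 1" if "dist w z < r / 2" for w
  proof -
    have "(dist w z)^2 \<le> (r / 2)^2" using that by (intro power_mono) auto
    then have "(dist w z)^2 \<le> r^2 / 4" by (simp add: power_divide)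
    then have "2 * (dist w z)^2 \<le> r^2" using zero_le_power2[of "dist w z"] by linarith
    then have "2 * (dist w z)^2 / r^2 \<le> 1" using assms by simp
    then show ?thesis by (intro smooth_step_eq_1) (simp add: q)
  qed
  moreover have "smooth_step (q w) = 0" if "dist w z \<ge> r" for w
  proof -
    have "(dist w z)^2 \<ge> r^2" using that assms by (intro power_mono) auto
    then have "2 * (dist w z)^2 / r^2 \<ge> 2" using assms by (simp add: field_simps)
    then show ?thesis by (intro smooth_step_eq_0) (simp add: q)
  qed
  ultimately show ?thesis using assms half_gt_zero by blast
qed

section \<open>Smooth functions in coordinates\<close>

lemma open_set_carrier: "smooth_atlas M \<Longrightarrow> open_set M (carrier_of M)"
  by (auto simp: open_set_def carrier_of_def smooth_atlas_def Int_absorb2 SUP_upper2)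

lemma open_set_Int: "smooth_atlas M \<Longrightarrow> open_set M V \<Longrightarrow> open_set M W \<Longrightarrow> open_set M (V \<inter> W)"
  using istopology_open_set[of M] unfolding istopology_def by blast

lemma open_set_subset_carrier: "open_set M W \<Longrightarrow> p \<in> W \<Longrightarrow> p \<in> carrier_of M"
  unfolding open_set_def by blast

lemma obtain_chart:
  assumes "p \<in> carrier_of M"
  obtains V \<psi> where "(V, \<psi>) \<in> M" "p \<in> V"
  using assms by (auto simp: carrier_of_def)

lemma compatible_commute: "compatible c d \<longleftrightarrow> compatible d c"
  by (auto simp: compatible_def Int_commute split: prod.splits)

text \<open>Makes atlas charts instances of the coordinate lemmas, so that charts and given
  coordinate systems are handled alike.\<close>

lemma coordinate_system_chart:
  assumes "smooth_atlas M" "(U, \<phi>) \<in> M"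
  shows "coordinate_system M U \<phi>"
proof -
  have "compatible (U, \<phi>) c" if "c \<in> M" for c
    using assms that by (auto simp: smooth_atlas_def)
  moreover have "open (\<psi> ` (V \<inter> U))" if "(V, \<psi>) \<in> M" for V \<psi>
    using calculation[OF that] by (auto simp: compatible_def Int_commute)
  moreover have "U \<subseteq> carrier_of M" using assms(2) by (force simp: carrier_of_def)
  ultimately show ?thesis
    using assms by (auto simp: coordinate_system_def open_set_def smooth_atlas_def)
qed

lemma coordinate_systemD:
  assumes "coordinate_system M U x"
  shows "open_set M U" "inj_on x U" "open (x ` U)"
    "(V, \<psi>) \<in> M \<Longrightarrow> open (x ` (U \<inter> V))" "(V, \<psi>) \<in> M \<Longrightarrow> open (\<psi> ` (U \<inter> V))"
    "(V, \<psi>) \<in> M \<Longrightarrow> smooth_on (\<lambda>z. \<psi> (inv_into U x z)) (x ` (U \<inter> V))"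
    "(V, \<psi>) \<in> M \<Longrightarrow> smooth_on (\<lambda>z. x (inv_into V \<psi> z)) (\<psi> ` (U \<inter> V))"
  using assms by (auto simp: coordinate_system_def compatible_def)

lemma coordinate_system_inv:
  assumes "coordinate_system M U x" "p \<in> U"
  shows "inv_into U x (x p) = p"
  using assms by (simp add: coordinate_system_def)

text \<open>\<open>open_set\<close> tests openness in charts of the atlas only; for other
  coordinates it is transported through the transition map to a chart around each point.\<close>

lemma open_coordinate_image:
  assumes M: "smooth_atlas M" and x: "coordinate_system M U x" and W: "open_set M W"
  shows "open (x ` (U \<inter> W))"
proof (subst open_subopen, clarify)
  fix p assume p: "p \<in> U" "p \<in> W"
  then obtain V \<psi> where c: "(V, \<psi>) \<in> M" "p \<in> V"
    using W open_set_subset_carrier obtain_chart by metis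
  note xD = coordinate_systemD[OF x] and cD = coordinate_systemD[OF coordinate_system_chart[OF M c(1)]]
  let ?T = "x ` (U \<inter> V) \<inter> (\<lambda>z. \<psi> (inv_into U x z)) -` (\<psi> ` (V \<inter> W))"
  have "open ?T"
    using xD(4)[OF c(1)] smooth_on_imp_continuous_on[OF xD(6)[OF c(1)]] W c(1)
    by (intro continuous_open_preimage) (auto simp: open_set_def)
  moreover have "x p \<in> ?T" using p c coordinate_system_inv[OF x] by auto
  moreover have "?T \<subseteq> x ` (U \<inter> W)"
  proof clarify
    fix q q' assume q: "q \<in> U" "q \<in> V" "\<psi> (inv_into U x (x q)) = \<psi> q'" "q' \<in> V" "q' \<in> W"
    then have "q = q'" using inj_onD[OF cD(2)] by (simp add: coordinate_system_inv[OF x])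
    with q show "x q \<in> x ` (U \<inter> W)" by blast
  qed
  ultimately show "\<exists>T. open T \<and> x p \<in> T \<and> T \<subseteq> x ` (U \<inter> W)" by blast
qed

lemma open_set_coordinate_preimage:
  assumes M: "smooth_atlas M" and x: "coordinate_system M U x" and S: "open S"
  shows "open_set M {p \<in> U. x p \<in> S}"
proof -
  note xD = coordinate_systemD[OF x]
  have "open (\<psi> ` (V \<inter> {p \<in> U. x p \<in> S}))" if c: "(V, \<psi>) \<in> M" for V \<psi>
  proof -
    note inv = coordinate_system_inv[OF coordinate_system_chart[OF M c]]
    have "\<psi> ` (V \<inter> {p \<in> U. x p \<in> S}) = \<psi> ` (U \<inter> V) \<inter> (\<lambda>z. x (inv_into V \<psi> z)) -` S"
      by (auto simp: inv)
    then show ?thesis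
      using xD(5)[OF c] smooth_on_imp_continuous_on[OF xD(7)[OF c]] S
      by (auto intro: continuous_open_preimage)
  qed
  moreover have "{p \<in> U. x p \<in> S} \<subseteq> carrier_of M"
    using xD(1) by (auto simp: open_set_def)
  ultimately show ?thesis by (auto simp: open_set_def)
qed

text \<open>\<open>smooth_fun\<close> speaks of atlas charts only. Near each point the coordinate
  expression is the chart expression composed with a smooth transition map, and smoothness is
  local.\<close>

lemma smooth_fun_coordinates:
  assumes M: "smooth_atlas M" and x: "coordinate_system M U x" and f: "smooth_fun M W f"
  shows "smooth_on (\<lambda>z. f (inv_into U x z)) (x ` (U \<inter> W))"
proof (rule smooth_on_local, clarify)
  fix p assume p: "p \<in> U" "p \<in> W"
  have W: "open_set M W" using f by (simp add: smooth_fun_def)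
  obtain V \<psi> where c: "(V, \<psi>) \<in> M" "p \<in> V"
    using W p open_set_subset_carrier obtain_chart by metis
  note cs = coordinate_system_chart[OF M c(1)]
  note xD = coordinate_systemD[OF x]
  let ?T = "x ` (U \<inter> (W \<inter> V))"
  have T: "open ?T"
    using coordinate_systemD(1)[OF cs] by (intro open_coordinate_image[OF M x] open_set_Int[OF M W])
  have "smooth_on (\<lambda>z. \<psi> (inv_into U x z)) ?T"
    using xD(6)[OF c(1)] by (rule smooth_on_subset) auto
  moreover have "smooth_on (\<lambda>z. f (inv_into V \<psi> z)) (\<psi> ` (V \<inter> W))"
    using f c(1) by (auto simp: smooth_fun_def)
  ultimately have "smooth_on (\<lambda>z. f (inv_into V \<psi> (\<psi> (inv_into U x z)))) ?T"
    by (rule smooth_on_compose[OF T]) (auto simp: coordinate_system_inv[OF x])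
  then have "smooth_on (\<lambda>z. f (inv_into U x z)) ?T"
    by (rule smooth_on_cong[OF T, rotated])
      (auto simp: coordinate_system_inv[OF x] coordinate_system_inv[OF cs])
  then show "\<exists>T. open T \<and> x p \<in> T \<and> smooth_on (\<lambda>z. f (inv_into U x z)) T"
    using T p c by blast
qed

text \<open>The converse passage: a single coordinate system covering \<open>W\<close> decides
  smoothness in all charts.\<close>

lemma smooth_fun_coordinatesI:
  assumes M: "smooth_atlas M" and x: "coordinate_system M U x" and W: "open_set M W" "W \<subseteq> U"
    and f: "smooth_on (\<lambda>z. f (inv_into U x z)) (x ` W)"
  shows "smooth_fun M W f"
proof -
  have "smooth_on (\<lambda>z. f (inv_into V \<psi> z)) (\<psi> ` (V \<inter> W))" if c: "(V, \<psi>) \<in> M" for V \<psi>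
  proof -
    note cs = coordinate_system_chart[OF M c]
    let ?T = "\<psi> ` (V \<inter> W)"
    have T: "open ?T" using W(1) c by (auto simp: open_set_def)
    have "smooth_on (\<lambda>z. x (inv_into V \<psi> z)) ?T"
      using coordinate_systemD(7)[OF x c] by (rule smooth_on_subset) (use W in auto)
    then have "smooth_on (\<lambda>z. f (inv_into U x (x (inv_into V \<psi> z)))) ?T"
      by (rule smooth_on_compose[OF T _ f]) (auto simp: coordinate_system_inv[OF cs])
    then show ?thesis
      by (rule smooth_on_cong[OF T, rotated])
        (use W in \<open>auto simp: coordinate_system_inv[OF x] coordinate_system_inv[OF cs] subset_iff\<close>)
  qed
  with W(1) show ?thesis by (auto simp: smooth_fun_def)
qed

lemma smooth_fun_subset:
  assumes M: "smooth_atlas M" and f: "smooth_fun M W f" and V: "open_set M V" "V \<subseteq> W"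
  shows "smooth_fun M V f"
proof -
  have "smooth_on (\<lambda>z. f (inv_into U \<phi> z)) (\<phi> ` (U \<inter> V))" if "(U, \<phi>) \<in> M" for U \<phi>
    by (rule smooth_on_subset[of _ "\<phi> ` (U \<inter> W)"]) (use f V that in \<open>auto simp: smooth_fun_def\<close>)
  with V show ?thesis by (auto simp: smooth_fun_def)
qed

lemma smooth_fun_cong:
  assumes M: "smooth_atlas M" and f: "smooth_fun M W f" and fg: "\<And>p. p \<in> W \<Longrightarrow> f p = g p"
  shows "smooth_fun M W g"
proof -
  have "smooth_on (\<lambda>z. g (inv_into V \<psi> z)) (\<psi> ` (V \<inter> W))" if c: "(V, \<psi>) \<in> M" for V \<psi>
    by (rule smooth_on_cong[of _ "\<lambda>z. f (inv_into V \<psi> z)"])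
      (use f c fg coordinate_system_inv[OF coordinate_system_chart[OF M c]] in
        \<open>auto simp: smooth_fun_def open_set_def\<close>)
  with f show ?thesis by (auto simp: smooth_fun_def)
qed

lemma smooth_fun_local:
  assumes M: "smooth_atlas M" and W: "open_set M W"
    and f: "\<And>p. p \<in> W \<Longrightarrow> smooth_near M p f"
  shows "smooth_fun M W f"
proof -
  have "smooth_on (\<lambda>z. f (inv_into V \<psi> z)) (\<psi> ` (V \<inter> W))" if c: "(V, \<psi>) \<in> M" for V \<psi>
  proof (rule smooth_on_local, clarify)
    fix p assume p: "p \<in> V" "p \<in> W"
    then obtain W' where W': "p \<in> W'" "smooth_fun M W' f"
      using f unfolding smooth_near_def by blast
    note cs = coordinate_system_chart[OF M c]
    have "smooth_on (\<lambda>z. f (inv_into V \<psi> z)) (\<psi> ` (V \<inter> W'))"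
      by (rule smooth_fun_coordinates[OF M cs W'(2)])
    moreover have "open (\<psi> ` (V \<inter> W'))"
      using W'(2) by (intro open_coordinate_image[OF M cs]) (simp add: smooth_fun_def)
    ultimately show "\<exists>T. open T \<and> \<psi> p \<in> T \<and> smooth_on (\<lambda>z. f (inv_into V \<psi> z)) T"
      using W'(1) p by blast
  qed
  with W show ?thesis by (auto simp: smooth_fun_def)
qed

lemma smooth_fun_imp_near: "smooth_fun M W f \<Longrightarrow> p \<in> W \<Longrightarrow> smooth_near M p f"
  unfolding smooth_near_def by blast

lemma smooth_fun_const: "open_set M W \<Longrightarrow> smooth_fun M W (\<lambda>p. c)"
  by (auto simp: smooth_fun_def smooth_on_const)

lemma smooth_fun_mult:
  "smooth_fun M W f \<Longrightarrow> smooth_fun M W g \<Longrightarrow> smooth_fun M W (\<lambda>p. f p * g p)"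
  by (auto simp: smooth_fun_def open_set_def intro!: smooth_on_mult)

lemma smooth_fun_coordinate:
  assumes M: "smooth_atlas M" and x: "coordinate_system M U x"
  shows "smooth_fun M U (\<lambda>p. x p \<bullet> b)"
proof (rule smooth_fun_coordinatesI[OF M x])
  have "smooth_on (\<lambda>z. z \<bullet> b) (x ` U)"
    using coordinate_systemD[OF x] by (intro smooth_on_bounded_linear bounded_linear_inner_left)
  then show "smooth_on (\<lambda>z. x (inv_into U x z) \<bullet> b) (x ` U)"
    by (rule smooth_on_cong[rotated 2])
      (use coordinate_systemD[OF x] in \<open>auto simp: coordinate_system_inv[OF x]\<close>)
qed (use coordinate_systemD[OF x] in auto)

lemma smooth_near_within:
  assumes M: "smooth_atlas M" and f: "smooth_near M p f" and U: "open_set M U" "p \<in> U"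
  obtains W where "p \<in> W" "W \<subseteq> U" "open_set M W" "smooth_fun M W f"
proof -
  obtain W where W: "p \<in> W" "smooth_fun M W f" using f by (auto simp: smooth_near_def)
  then have "open_set M (U \<inter> W)" using U by (intro open_set_Int M) (auto simp: smooth_fun_def)
  then show ?thesis
    using W U smooth_fun_subset[OF M W(2), of "U \<inter> W"] by (intro that[of "U \<inter> W"]) auto
qed

lemma smooth_near_cong:
  assumes M: "smooth_atlas M" and W: "open_set M W" "p \<in> W" and fg: "\<And>q. q \<in> W \<Longrightarrow> f q = g q"
    and f: "smooth_near M p f"
  shows "smooth_near M p g"
proof -
  obtain V where "p \<in> V" "V \<subseteq> W" "open_set M V" "smooth_fun M V f"
    using smooth_near_within[OF M f W] .
  then show ?thesis using smooth_fun_cong[OF M, of V f g] fg unfolding smooth_near_def by blast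
qed

section \<open>Tangent vectors and vector fields in coordinates\<close>

text \<open>The inverse of the differential of \<open>x\<close> at \<open>p\<close>. The value
  \<open>0\<close> off the smooth germs agrees with \<open>velocity\<close>, so that equality with
  members of \<open>tangent_space\<close> is equality of operators.\<close>

definition coord_vector :: "('a, 'e::euclidean_space) atlas \<Rightarrow> 'a set \<Rightarrow> ('a \<Rightarrow> 'e) \<Rightarrow> 'a \<Rightarrow> 'e \<Rightarrow> 'a tvec" where
  "coord_vector M U x p a = (\<lambda>f. if smooth_near M p f
     then frechet_derivative (\<lambda>z. f (inv_into U x z)) (at (x p)) a else 0)"

definition vec_coords :: "('a \<Rightarrow> 'e::euclidean_space) \<Rightarrow> 'a tvec \<Rightarrow> 'e" where
  "vec_coords x v = (\<Sum>b\<in>Basis. v (\<lambda>q. x q \<bullet> b) *\<^sub>R b)"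

lemma smooth_near_coordinates:
  assumes M: "smooth_atlas M" and x: "coordinate_system M U x" and p: "p \<in> U" and f: "smooth_near M p f"
  obtains T where "open T" "x p \<in> T" "T \<subseteq> x ` U" "smooth_on (\<lambda>z. f (inv_into U x z)) T"
proof -
  obtain W where W: "p \<in> W" "W \<subseteq> U" "open_set M W" "smooth_fun M W f"
    using smooth_near_within[OF M f coordinate_systemD(1)[OF x] p] .
  show ?thesis
    using W p smooth_fun_coordinates[OF M x W(4)] open_coordinate_image[OF M x W(3)]
    by (intro that[of "x ` (U \<inter> W)"]) auto
qed

lemma smooth_nearI:
  assumes M: "smooth_atlas M" and x: "coordinate_system M U x" and p: "p \<in> U"
    and T: "open T" "x p \<in> T" "T \<subseteq> x ` U" "smooth_on (\<lambda>z. f (inv_into U x z)) T"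
  shows "smooth_near M p f"
proof -
  let ?W = "{q \<in> U. x q \<in> T}"
  have "smooth_fun M ?W f"
  proof (rule smooth_fun_coordinatesI[OF M x open_set_coordinate_preimage[OF M x T(1)]])
    show "smooth_on (\<lambda>z. f (inv_into U x z)) (x ` ?W)"
      using T(4) by (rule smooth_on_subset) auto
  qed auto
  then show ?thesis using p T(2) by (intro smooth_fun_imp_near[of M ?W]) auto
qed

lemma smooth_near_has_derivative:
  assumes M: "smooth_atlas M" and x: "coordinate_system M U x" and p: "p \<in> U" and f: "smooth_near M p f"
  shows "((\<lambda>z. f (inv_into U x z)) has_derivative (\<lambda>a. coord_vector M U x p a f)) (at (x p))"
proof -
  obtain T where "open T" "x p \<in> T" "T \<subseteq> x ` U" "smooth_on (\<lambda>z. f (inv_into U x z)) T"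
    using smooth_near_coordinates[OF assms] .
  from smooth_on_has_derivative[OF this(4,2)] show ?thesis
    using f by (simp add: coord_vector_def)
qed

text \<open>The way tangent vectors are evaluated below: by uniqueness of derivatives, any
  derivative found for the coordinate expression will do.\<close>

lemma coord_vector_eqI:
  assumes M: "smooth_atlas M" and x: "coordinate_system M U x" and p: "p \<in> U" and f: "smooth_near M p f"
    and D: "((\<lambda>z. f (inv_into U x z)) has_derivative D) (at (x p))"
  shows "coord_vector M U x p a f = D a"
  using has_derivative_unique[OF D smooth_near_has_derivative[OF M x p f]] by simp

lemma coord_vector_linear:
  assumes M: "smooth_atlas M" and x: "coordinate_system M U x" and p: "p \<in> U"
  shows "coord_vector M U x p (s *\<^sub>R a + t *\<^sub>R b) = s \<cdot> coord_vector M U x p a + t \<cdot> coord_vector M U x p b"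
proof
  fix f
  show "coord_vector M U x p (s *\<^sub>R a + t *\<^sub>R b) f = (s \<cdot> coord_vector M U x p a + t \<cdot> coord_vector M U x p b) f"
  proof (cases "smooth_near M p f")
    case True
    have "linear (\<lambda>a. coord_vector M U x p a f)"
      by (rule has_derivative_linear[OF smooth_near_has_derivative[OF M x p True]])
    from linear_add[OF this] linear_cmul[OF this] show ?thesis by (simp add: scale_def)
  qed (simp add: coord_vector_def scale_def)
qed

lemma coord_vector_coordinate:
  assumes M: "smooth_atlas M" and x: "coordinate_system M U x" and p: "p \<in> U"
  shows "coord_vector M U x p a (\<lambda>q. x q \<bullet> b) = a \<bullet> b"
proof -
  have "((\<lambda>z. z \<bullet> b) has_derivative (\<lambda>a. a \<bullet> b)) (at (x p))"
    by (intro bounded_linear_imp_has_derivative bounded_linear_inner_left)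
  then have "((\<lambda>z. x (inv_into U x z) \<bullet> b) has_derivative (\<lambda>a. a \<bullet> b)) (at (x p))"
    by (rule has_derivative_transform_within_open[of _ _ _ _ "x ` U"])
      (use coordinate_systemD[OF x] p in \<open>auto simp: coordinate_system_inv[OF x]\<close>)
  then show ?thesis
    using coord_vector_eqI[OF M x p] smooth_fun_imp_near[OF smooth_fun_coordinate[OF M x] p] by blast
qed

lemma vec_coords_coord_vector:
  assumes "smooth_atlas M" "coordinate_system M U x" "p \<in> U"
  shows "vec_coords x (coord_vector M U x p a) = a"
  by (simp add: vec_coords_def coord_vector_coordinate[OF assms] euclidean_representation)

lemma velocity_eq_coord_vector:
  assumes M: "smooth_atlas M" and x: "coordinate_system M U x" and p: "\<gamma> 0 \<in> U"
    and T: "open T" "0 \<in> T" "\<gamma> ` T \<subseteq> U" and d: "((\<lambda>t. x (\<gamma> t)) has_vector_derivative a) (at 0)"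
  shows "velocity M \<gamma> = coord_vector M U x (\<gamma> 0) a"
proof
  fix f
  show "velocity M \<gamma> f = coord_vector M U x (\<gamma> 0) a f"
  proof (cases "smooth_near M (\<gamma> 0) f")
    case True
    let ?D = "\<lambda>a. coord_vector M U x (\<gamma> 0) a f"
    note fd = smooth_near_has_derivative[OF M x p True]
    have "((\<lambda>t. f (inv_into U x (x (\<gamma> t)))) has_derivative (\<lambda>h. ?D (h *\<^sub>R a))) (at 0)"
      using has_derivative_compose[OF d[unfolded has_vector_derivative_def] fd] .
    then have "((\<lambda>t. f (\<gamma> t)) has_derivative (\<lambda>h. ?D (h *\<^sub>R a))) (at 0)"
      by (rule has_derivative_transform_within_open[OF _ T(1,2)])
        (use T(3) in \<open>auto simp: coordinate_system_inv[OF x] subset_iff image_subset_iff\<close>)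
    moreover have "(\<lambda>h. ?D (h *\<^sub>R a)) = (*) (?D a)"
      using linear_cmul[OF has_derivative_linear[OF fd]] by auto
    ultimately have "((\<lambda>t. f (\<gamma> t)) has_real_derivative ?D a) (at 0)"
      by (simp add: has_field_derivative_def)
    then have "deriv (\<lambda>t. f (\<gamma> t)) 0 = ?D a" by (rule DERIV_imp_deriv)
    then show ?thesis using True by (simp add: velocity_def)
  qed (simp add: velocity_def coord_vector_def)
qed

lemma velocity_coordinate_line:
  assumes M: "smooth_atlas M" and x: "coordinate_system M U x" and p: "p \<in> U"
  shows "velocity M (\<lambda>t. inv_into U x (x p + t *\<^sub>R a)) = coord_vector M U x p a"
proof -
  let ?\<gamma> = "\<lambda>t. inv_into U x (x p + t *\<^sub>R a)"
  let ?T = "(\<lambda>t. x p + t *\<^sub>R a) -` (x ` U)"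
  have T: "open ?T"
    by (rule open_vimage[OF coordinate_systemD(3)[OF x]]) (auto intro!: continuous_intros)
  have d: "((\<lambda>t. x p + t *\<^sub>R a) has_vector_derivative a) (at 0)"
    by (auto intro!: derivative_eq_intros)
  have "((\<lambda>t. x (?\<gamma> t)) has_vector_derivative a) (at 0)"
    by (rule has_vector_derivative_transform_within_open[OF d T])
      (use p in \<open>auto simp: f_inv_into_f\<close>)
  moreover have "?\<gamma> ` ?T \<subseteq> U" by (auto simp: inv_into_into)
  ultimately show ?thesis
    using velocity_eq_coord_vector[OF M x, of ?\<gamma> ?T a] T p by (simp add: coordinate_system_inv[OF x p])
qed

lemma smooth_curve_coordinate_line:
  assumes M: "smooth_atlas M" and x: "coordinate_system M U x" and p: "p \<in> U"
  shows "smooth_curve M (\<lambda>t. inv_into U x (x p + t *\<^sub>R a))"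
proof -
  let ?l = "\<lambda>t. x p + t *\<^sub>R a"
  obtain V \<psi> where c: "(V, \<psi>) \<in> M" "p \<in> V"
    using p coordinate_systemD(1)[OF x] open_set_subset_carrier obtain_chart by metis
  have "open (?l -` (x ` (U \<inter> V)))"
    by (rule open_vimage[OF coordinate_systemD(4)[OF x c(1)]]) (auto intro!: continuous_intros)
  moreover have "0 \<in> ?l -` (x ` (U \<inter> V))" using p c by auto
  ultimately obtain e where e: "e > 0" "ball 0 e \<subseteq> ?l -` (x ` (U \<inter> V))"
    using open_contains_ball by blast
  have I: "{-e<..<e} = ball 0 e" by (auto simp: dist_real_def)
  have l: "?l ` {-e<..<e} \<subseteq> x ` (U \<inter> V)" using e(2) I by auto
  have "smooth_on ?l {-e<..<e}"
    by (intro smooth_on_add smooth_on_const smooth_on_scaleR smooth_on_bounded_linear bounded_linear_ident) auto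
  then have "smooth_on (\<lambda>t. \<psi> (inv_into U x (?l t))) {-e<..<e}"
    using l by (intro smooth_on_compose[OF _ _ coordinate_systemD(6)[OF x c(1)]]) auto
  moreover have "(\<lambda>t. inv_into U x (?l t)) ` {-e<..<e} \<subseteq> V"
    using l by (auto simp: image_subset_iff coordinate_system_inv[OF x])
  ultimately show ?thesis using c(1) e(1) unfolding smooth_curve_def by blast
qed

text \<open>A vector with components \<open>a\<close> is the velocity of a coordinate line.
  Conversely, a curve is given as smooth in some chart; near time \<open>0\<close> a transition map
  makes it differentiable in \<open>x\<close>, and the chain rule reads off its velocity.\<close>

lemma tangent_space_eq_range:
  assumes M: "smooth_atlas M" and x: "coordinate_system M U x" and p: "p \<in> U"
  shows "tangent_space M p = range (coord_vector M U x p)"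
proof (intro equalityI subsetI)
  fix v assume "v \<in> range (coord_vector M U x p)"
  then obtain a where "v = coord_vector M U x p a" by blast
  then show "v \<in> tangent_space M p"
    using velocity_coordinate_line[OF M x p, of a] smooth_curve_coordinate_line[OF M x p, of a]
      coordinate_system_inv[OF x p]
    by (auto simp: tangent_space_def intro!: exI[of _ "\<lambda>t. inv_into U x (x p + t *\<^sub>R a)"])
next
  fix v assume "v \<in> tangent_space M p"
  then obtain \<gamma> where \<gamma>: "v = velocity M \<gamma>" "smooth_curve M \<gamma>" "\<gamma> 0 = p"
    by (auto simp: tangent_space_def)
  then obtain V \<psi> e where c: "(V, \<psi>) \<in> M" and e: "e > 0" "\<gamma> ` {-e<..<e} \<subseteq> V"
    and s: "smooth_on (\<lambda>t. \<psi> (\<gamma> t)) {-e<..<e}"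
    unfolding smooth_curve_def by blast
  note cs = coordinate_system_chart[OF M c]
  \<comment> \<open>Times at which the curve is in \<open>U\<close>. They are described through
    \<open>\<psi>\<close> because smoothness of the curve is known in that chart, where
    \<open>U \<inter> V\<close> has an open image.\<close>
  define T where "T = {-e<..<e} \<inter> (\<lambda>t. \<psi> (\<gamma> t)) -` (\<psi> ` (U \<inter> V))"
  have T: "open T" unfolding T_def
    using coordinate_systemD(5)[OF x c] smooth_on_imp_continuous_on[OF s]
    by (intro continuous_open_preimage) auto
  have pV: "p \<in> V" using e \<gamma>(3) by auto
  have T0: "0 \<in> T" using e \<gamma>(3) p pV by (auto simp: T_def)
  have TU: "\<gamma> t \<in> U" if "t \<in> T" for t
  proof -
    from that obtain q where q: "\<psi> (\<gamma> t) = \<psi> q" "q \<in> U" "q \<in> V" "\<gamma> t \<in> V"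
      using e(2) by (auto simp: T_def image_subset_iff)
    then show ?thesis using inj_onD[OF coordinate_systemD(2)[OF cs]] by metis
  qed
  have "smooth_on (\<lambda>t. \<psi> (\<gamma> t)) T" using s by (rule smooth_on_subset) (auto simp: T_def)
  then have "smooth_on (\<lambda>t. x (inv_into V \<psi> (\<psi> (\<gamma> t)))) T"
    by (rule smooth_on_compose[OF T _ coordinate_systemD(7)[OF x c]]) (auto simp: T_def)
  then have "smooth_on (\<lambda>t. x (\<gamma> t)) T"
    by (rule smooth_on_cong[OF T, rotated])
      (use e(2) in \<open>auto simp: T_def coordinate_system_inv[OF cs] image_subset_iff\<close>)
  then have "(\<lambda>t. x (\<gamma> t)) differentiable (at 0)" using T0 by (rule smooth_on_differentiable)
  then have "((\<lambda>t. x (\<gamma> t)) has_vector_derivative vector_derivative (\<lambda>t. x (\<gamma> t)) (at 0)) (at 0)"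
    by (simp add: vector_derivative_works)
  then have "v = coord_vector M U x p (vector_derivative (\<lambda>t. x (\<gamma> t)) (at 0))"
    using velocity_eq_coord_vector[OF M x _ T T0, of \<gamma>] TU p \<gamma> by auto
  then show "v \<in> range (coord_vector M U x p)" by blast
qed

lemma coord_field_eq:
  assumes "smooth_atlas M" "coordinate_system M U x" "p \<in> U"
  shows "coord_field M U x i p = coord_vector M U x p (axis i 1)"
  using velocity_coordinate_line[OF assms, of "axis i 1"] by (simp add: coord_field_def)

lemma coord_vector_tangent:
  assumes "smooth_atlas M" "coordinate_system M U x" "p \<in> U"
  shows "coord_vector M U x p a \<in> tangent_space M p"
  using tangent_space_eq_range[OF assms] by blast

lemma coord_vector_vec_coords:
  assumes "smooth_atlas M" "coordinate_system M U x" "p \<in> U" "v \<in> tangent_space M p"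
  shows "coord_vector M U x p (vec_coords x v) = v"
  using assms(4) tangent_space_eq_range[OF assms(1-3)] vec_coords_coord_vector[OF assms(1-3)] by auto

text \<open>Functions that are not smooth near \<open>p\<close> are covered as well: smoothness near
  \<open>p\<close> is a property of the germ, and otherwise both values are
  \<open>0\<close>.\<close>

lemma tangent_vector_germ:
  assumes M: "smooth_atlas M" and v: "v \<in> tangent_space M p"
    and W: "open_set M W" "p \<in> W" and fg: "\<And>q. q \<in> W \<Longrightarrow> f q = g q"
  shows "v f = v g"
proof -
  obtain V \<psi> where c: "(V, \<psi>) \<in> M" "p \<in> V"
    using W open_set_subset_carrier obtain_chart by metis
  note cs = coordinate_system_chart[OF M c(1)]
  obtain a where a: "v = coord_vector M V \<psi> p a"
    using v tangent_space_eq_range[OF M cs c(2)] by blast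
  have sn: "smooth_near M p f \<longleftrightarrow> smooth_near M p g"
    using smooth_near_cong[OF M W, of f g] smooth_near_cong[OF M W, of g f] fg by auto
  show ?thesis
  proof (cases "smooth_near M p f")
    case True
    have "((\<lambda>z. g (inv_into V \<psi> z)) has_derivative (\<lambda>a. coord_vector M V \<psi> p a f)) (at (\<psi> p))"
      by (rule has_derivative_transform_within_open[OF smooth_near_has_derivative[OF M cs c(2) True],
          of "\<psi> ` (V \<inter> W)"])
        (use W c fg open_coordinate_image[OF M cs W(1)] in \<open>auto simp: coordinate_system_inv[OF cs]\<close>)
    then show ?thesis using coord_vector_eqI[OF M cs c(2)] True sn a by metis
  qed (use sn a in \<open>simp add: coord_vector_def\<close>)
qed

lemma vector_fieldD:
  assumes "vector_field M W X"
  shows "open_set M W" "p \<in> W \<Longrightarrow> X p \<in> tangent_space M p" "p \<notin> W \<Longrightarrow> X p = 0"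
    "V \<subseteq> W \<Longrightarrow> smooth_fun M V f \<Longrightarrow> smooth_fun M V (\<lambda>p. X p f)"
  using assms by (auto simp: vector_field_def)

lemma smooth_on_vector_field_coords:
  assumes M: "smooth_atlas M" and x: "coordinate_system M U x" and X: "vector_field M W X"
  shows "smooth_on (\<lambda>z. vec_coords x (X (inv_into U x z))) (x ` (U \<inter> W))"
proof -
  have UW: "open_set M (U \<inter> W)"
    using coordinate_systemD(1)[OF x] vector_fieldD(1)[OF X] by (rule open_set_Int[OF M])
  have "smooth_on (\<lambda>z. X (inv_into U x z) (\<lambda>q. x q \<bullet> b)) (x ` (U \<inter> W))" for b
  proof -
    have "smooth_fun M (U \<inter> W) (\<lambda>p. X p (\<lambda>q. x q \<bullet> b))"
      by (rule vector_fieldD(4)[OF X _ smooth_fun_subset[OF M smooth_fun_coordinate[OF M x] UW]]) auto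
    from smooth_fun_coordinates[OF M x this] show ?thesis by (simp add: Int_absorb1)
  qed
  then show ?thesis unfolding vec_coords_def
    using open_coordinate_image[OF M x vector_fieldD(1)[OF X]]
    by (intro smooth_on_sum smooth_on_scaleR smooth_on_const)
qed

text \<open>In coordinates, applying the field to \<open>f\<close> is the tangent map of
  \<open>f\<close> composed with \<open>z \<mapsto> (z, c z)\<close>.\<close>

lemma vector_field_coordinatesI:
  assumes M: "smooth_atlas M" and x: "coordinate_system M U x" and W: "open_set M W" "W \<subseteq> U"
    and c: "smooth_on c (x ` W)"
    and X: "\<And>p. p \<in> W \<Longrightarrow> X p = coord_vector M U x p (c (x p))" "\<And>p. p \<notin> W \<Longrightarrow> X p = 0"
  shows "vector_field M W X"
  unfolding vector_field_def
proof (intro conjI allI ballI impI; (elim conjE)?)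
  fix p assume "p \<in> W"
  then show "X p \<in> tangent_space M p" using X W coord_vector_tangent[OF M x] by auto
next
  fix V f assume V: "V \<subseteq> W" and f: "smooth_fun M V f"
  have Vo: "open_set M V" using f by (simp add: smooth_fun_def)
  show "smooth_fun M V (\<lambda>p. X p f)"
  proof (rule smooth_fun_coordinatesI[OF M x Vo])
    have UV: "U \<inter> V = V" using V W by auto
    have o: "open (x ` V)" using open_coordinate_image[OF M x Vo] by (simp add: UV)
    have "smooth_on (\<lambda>z. (z, c z)) (x ` V)"
      by (intro smooth_on_Pair o smooth_on_bounded_linear bounded_linear_ident smooth_on_subset[OF c])
        (use V in auto)
    moreover have "smooth_on (\<lambda>z. f (inv_into U x z)) (x ` V)"
      using smooth_fun_coordinates[OF M x f] by (simp add: UV)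
    ultimately have "smooth_on (\<lambda>z. case (z, c z) of (z, v) \<Rightarrow>
        frechet_derivative (\<lambda>z. f (inv_into U x z)) (at z) v) (x ` V)"
      by (intro smooth_on_compose[OF o _ smooth_on_tangent_map[OF o]]) auto
    then show "smooth_on (\<lambda>z. X (inv_into U x z) f) (x ` V)"
      by (rule smooth_on_cong[OF o, rotated])
        (use V W smooth_fun_imp_near[OF f] in
          \<open>auto simp: X coord_vector_def coordinate_system_inv[OF x] subset_iff\<close>)
  qed (use V W in auto)
qed (use W X in auto)

section \<open>Extending local objects by bump functions\<close>

text \<open>The support condition is phrased by an open set \<open>B\<close> on which
  \<open>\<rho>\<close> vanishes and which covers the manifold together with \<open>U\<close>.
  Smoothness of an object cut off by \<open>\<rho>\<close> can then be checked on two open sets, as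
  a product on \<open>U\<close> and as zero on \<open>B\<close>.\<close>

definition cutoff :: "('a, 'e::euclidean_space) atlas \<Rightarrow> 'a set \<Rightarrow> 'a set \<Rightarrow> ('a \<Rightarrow> real) \<Rightarrow> bool" where
  "cutoff M U A \<rho> \<longleftrightarrow> open_set M A \<and> A \<subseteq> U \<and> smooth_fun M (carrier_of M) \<rho> \<and> (\<forall>q\<in>A. \<rho> q = 1) \<and>
     (\<exists>B. open_set M B \<and> U \<union> B = carrier_of M \<and> (\<forall>q\<in>B. \<rho> q = 0))"

lemma openin_manifold_topology: "smooth_atlas M \<Longrightarrow> openin (manifold_topology M) = open_set M"
  unfolding manifold_topology_def by (rule topology_inverse'[OF istopology_open_set])

lemma topspace_manifold_topology:
  assumes "smooth_atlas M" shows "topspace (manifold_topology M) = carrier_of M"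
  unfolding topspace_def openin_manifold_topology[OF assms]
  using open_set_carrier[OF assms] by (auto simp: open_set_def)

text \<open>The complement of a compact coordinate ball is open by the Hausdorff property.\<close>

lemma ex_cutoff:
  assumes man: "smooth_manifold M" and x: "coordinate_system M U x" and p: "p \<in> U"
  shows "\<exists>A \<rho>. cutoff M U A \<rho> \<and> p \<in> A"
proof -
  have M: "smooth_atlas M" and H: "Hausdorff_space (manifold_topology M)"
    using man by (auto simp: smooth_manifold_def)
  note xD = coordinate_systemD[OF x]
  obtain r where r: "r > 0" "cball (x p) r \<subseteq> x ` U"
    using xD(3) p open_contains_cball by blast
  obtain f d where f: "smooth_on f UNIV" and d: "d > 0" "\<And>w. dist w (x p) < d \<Longrightarrow> f w = 1"
    and f0: "\<And>w. dist w (x p) \<ge> r \<Longrightarrow> f w = (0::real)"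
    using smooth_bump[OF r(1), of "x p"] by blast
  define C where "C = inv_into U x ` cball (x p) r"
  define B where "B = carrier_of M - C"
  define A where "A = {q \<in> U. x q \<in> ball (x p) d}"
  define \<rho> where "\<rho> q = (if q \<in> U then f (x q) else 0)" for q
  \<comment> \<open>Carries compactness of the closed ball in coordinate space over to
    \<open>C\<close>.\<close>
  have "continuous_map (top_of_set (x ` U)) (manifold_topology M) (inv_into U x)"
    unfolding continuous_map_def topspace_manifold_topology[OF M] openin_manifold_topology[OF M]
  proof (intro conjI allI impI)
    show "inv_into U x \<in> topspace (top_of_set (x ` U)) \<rightarrow> carrier_of M"
      using xD(1) by (auto simp: inv_into_into open_set_def subset_iff)
    fix S assume S: "open_set M S"
    have "{z \<in> topspace (top_of_set (x ` U)). inv_into U x z \<in> S} = x ` (U \<inter> S)"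
      by (auto simp: coordinate_system_inv[OF x])
    then show "openin (top_of_set (x ` U)) {z \<in> topspace (top_of_set (x ` U)). inv_into U x z \<in> S}"
      using open_coordinate_image[OF M x S] by (auto intro: open_subset)
  qed
  then have "compactin (manifold_topology M) C"
    unfolding C_def by (rule image_compactin[rotated]) (use r in \<open>simp add: compactin_subtopology\<close>)
  then have "closedin (manifold_topology M) C" using H by (rule compactin_imp_closedin[rotated])
  then have B: "open_set M B"
    by (simp add: B_def closedin_def topspace_manifold_topology[OF M] openin_manifold_topology[OF M])
  have "C \<subseteq> U" using r(2) by (auto simp: C_def intro: inv_into_into)
  then have UB: "U \<union> B = carrier_of M" using xD(1) by (auto simp: B_def open_set_def)
  have \<rho>B: "\<rho> q = 0" if "q \<in> B" for q
  proof (cases "q \<in> U")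
    case True
    have "x q \<notin> cball (x p) r"
    proof
      assume "x q \<in> cball (x p) r"
      then have "inv_into U x (x q) \<in> C" by (simp add: C_def)
      then show False using that True by (simp add: B_def coordinate_system_inv[OF x])
    qed
    then show ?thesis using True f0 by (simp add: \<rho>_def dist_commute)
  qed (simp add: \<rho>_def)
  have "smooth_on (\<lambda>z. \<rho> (inv_into U x z)) (x ` U)"
    by (rule smooth_on_cong[OF xD(3) _ smooth_on_subset[OF f]])
      (auto simp: \<rho>_def coordinate_system_inv[OF x])
  then have "smooth_fun M U \<rho>" by (intro smooth_fun_coordinatesI[OF M x]) (use xD in auto)
  moreover have "smooth_fun M B \<rho>"
    using smooth_fun_cong[OF M smooth_fun_const[OF B]] \<rho>B by metis
  ultimately have "smooth_fun M (carrier_of M) \<rho>"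
    using UB by (intro smooth_fun_local[OF M open_set_carrier[OF M]]) (auto intro: smooth_fun_imp_near)
  moreover have "open_set M A" unfolding A_def by (intro open_set_coordinate_preimage[OF M x]) auto
  moreover have "\<rho> q = 1" if "q \<in> A" for q
    using that d(2)[of "x q"] by (auto simp: A_def \<rho>_def dist_commute)
  moreover have "p \<in> A" using p d by (simp add: A_def)
  ultimately have "cutoff M U A \<rho>"
    unfolding cutoff_def using B UB \<rho>B by (auto simp: A_def)
  then show ?thesis using \<open>p \<in> A\<close> by blast
qed

lemma smooth_fun_cutoff:
  assumes M: "smooth_atlas M" and \<rho>: "cutoff M U A \<rho>" and f: "smooth_fun M U f"
  shows "smooth_fun M (carrier_of M) (\<lambda>q. if q \<in> U then \<rho> q * f q else 0)"
    (is "smooth_fun M _ ?g")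
proof -
  obtain B where B: "open_set M B" "U \<union> B = carrier_of M" "\<And>q. q \<in> B \<Longrightarrow> \<rho> q = 0"
    and \<rho>s: "smooth_fun M (carrier_of M) \<rho>"
    using \<rho> by (auto simp: cutoff_def)
  have U: "open_set M U" using f by (simp add: smooth_fun_def)
  have "smooth_fun M U ?g"
    by (rule smooth_fun_cong[OF M smooth_fun_mult[OF smooth_fun_subset[OF M \<rho>s U] f]]) (use B in auto)
  moreover have "smooth_fun M B ?g"
    by (rule smooth_fun_cong[OF M smooth_fun_const[OF B(1), of 0]]) (use B in auto)
  ultimately show ?thesis
    using B(2) by (intro smooth_fun_local[OF M open_set_carrier[OF M]]) (auto intro: smooth_fun_imp_near)
qed

lemma zero_in_tangent_space:
  assumes M: "smooth_atlas M" and p: "p \<in> carrier_of M"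
  shows "0 \<in> tangent_space M p"
proof -
  obtain V \<psi> where c: "(V, \<psi>) \<in> M" "p \<in> V" using p by (rule obtain_chart)
  note cs = coordinate_system_chart[OF M c(1)]
  have "coord_vector M V \<psi> p 0 = 0"
    using coord_vector_linear[OF M cs c(2), of 0 0 0 0] by (simp add: scale_def zero_fun_def)
  then show ?thesis using coord_vector_tangent[OF M cs c(2), of 0] by simp
qed

lemma scale_in_tangent_space:
  assumes M: "smooth_atlas M" and p: "p \<in> carrier_of M" and v: "v \<in> tangent_space M p"
  shows "s \<cdot> v \<in> tangent_space M p"
proof -
  obtain V \<psi> where c: "(V, \<psi>) \<in> M" "p \<in> V" using p by (rule obtain_chart)
  note cs = coordinate_system_chart[OF M c(1)]
  obtain a where "v = coord_vector M V \<psi> p a"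
    using v tangent_space_eq_range[OF M cs c(2)] by blast
  then have "s \<cdot> v = coord_vector M V \<psi> p (s *\<^sub>R a)"
    using coord_vector_linear[OF M cs c(2), of s a 0 0] by (simp add: scale_def plus_fun_def)
  then show ?thesis using coord_vector_tangent[OF M cs c(2)] by simp
qed

lemma global_field_cutoff:
  assumes M: "smooth_atlas M" and \<rho>: "cutoff M U A \<rho>" and X: "vector_field M U X"
  shows "global_field M (\<lambda>q. \<rho> q \<cdot> X q)"
proof -
  obtain B where B: "open_set M B" "U \<union> B = carrier_of M" "\<And>q. q \<in> B \<Longrightarrow> \<rho> q = 0"
    and \<rho>s: "smooth_fun M (carrier_of M) \<rho>"
    using \<rho> by (auto simp: cutoff_def)
  note XD = vector_fieldD[OF X]
  show ?thesis unfolding vector_field_def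
  proof (intro conjI allI ballI impI; (elim conjE)?)
    show "open_set M (carrier_of M)" by (rule open_set_carrier[OF M])
    fix p
    have "X p \<in> tangent_space M p" if "p \<in> carrier_of M"
      using XD(2,3) zero_in_tangent_space[OF M that] by (cases "p \<in> U") auto
    then show "\<rho> p \<cdot> X p \<in> tangent_space M p" if "p \<in> carrier_of M"
      using scale_in_tangent_space[OF M] that by blast
    show "\<rho> p \<cdot> X p = 0" if "p \<notin> carrier_of M"
    proof -
      have "X p = 0" using XD(3)[of p] B(2) that by blast
      then show ?thesis by (simp add: scale_def zero_fun_def)
    qed
  next
    fix V f assume V: "V \<subseteq> carrier_of M" and f: "smooth_fun M V f"
    have Vo: "open_set M V" using f by (simp add: smooth_fun_def)
    have 1: "open_set M (V \<inter> U)" "open_set M (V \<inter> B)"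
      using Vo XD(1) B(1) by (auto intro: open_set_Int[OF M])
    have "smooth_fun M (V \<inter> U) (\<lambda>p. \<rho> p * X p f)"
      using 1 V smooth_fun_subset[OF M f 1(1)] smooth_fun_subset[OF M \<rho>s 1(1)]
      by (intro smooth_fun_mult XD(4)) auto
    moreover have "smooth_fun M (V \<inter> B) (\<lambda>p. \<rho> p * X p f)"
      by (rule smooth_fun_cong[OF M smooth_fun_const[OF 1(2), of 0]]) (use B in auto)
    ultimately have "smooth_near M q (\<lambda>p. \<rho> p * X p f)" if "q \<in> V" for q
      using that V B(2) smooth_fun_imp_near[of M _ _ q] by (metis IntI UnE subsetD)
    then show "smooth_fun M V (\<lambda>p. (\<rho> p \<cdot> X p) f)"
      unfolding scale_def by (intro smooth_fun_local[OF M Vo])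
  qed
qed

section \<open>The tangent bundle\<close>

text \<open>Domain and map of \<open>tangent_chart\<close>, separated so that they also apply to
  coordinate systems outside the atlas.\<close>

definition tangent_over :: "('a, 'e::euclidean_space) atlas \<Rightarrow> 'a set \<Rightarrow> 'a tpoint set" where
  "tangent_over M U = {(p, v). p \<in> U \<and> v \<in> tangent_space M p}"

definition tangent_coords :: "('a \<Rightarrow> 'e::euclidean_space) \<Rightarrow> 'a tpoint \<Rightarrow> 'e \<times> 'e" where
  "tangent_coords x = (\<lambda>(p, v). (x p, vec_coords x v))"

lemma tangent_coords_Pair: "tangent_coords x (p, v) = (x p, vec_coords x v)"
  by (simp add: tangent_coords_def)

lemma tangent_chart_eq: "tangent_chart M (U, x) = (tangent_over M U, tangent_coords x)"
  by (simp add: tangent_chart_def tangent_over_def tangent_coords_def vec_coords_def)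

lemma tangent_over_Int: "tangent_over M U \<inter> tangent_over M V = tangent_over M (U \<inter> V)"
  by (auto simp: tangent_over_def)

lemma carrier_of_tangent_bundle: "carrier_of (tangent_bundle M) = tangent_over M (carrier_of M)"
  by (force simp: carrier_of_def tangent_bundle_def tangent_chart_def tangent_over_def split: prod.splits)

lemma inj_on_tangent_coords:
  assumes M: "smooth_atlas M" and x: "coordinate_system M U x"
  shows "inj_on (tangent_coords x) (tangent_over M U)"
proof (rule inj_onI, clarify)
  fix p v q w assume a: "(p, v) \<in> tangent_over M U" "(q, w) \<in> tangent_over M U"
    "tangent_coords x (p, v) = tangent_coords x (q, w)"
  then have "p = q" using inj_onD[OF coordinate_systemD(2)[OF x]]
    by (auto simp: tangent_over_def tangent_coords_def)
  moreover have "v = w"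
    using a coord_vector_vec_coords[OF M x] \<open>p = q\<close>
    by (auto simp: tangent_over_def tangent_coords_def) metis
  ultimately show "p = q \<and> v = w" by simp
qed

lemma tangent_coords_image:
  assumes M: "smooth_atlas M" and x: "coordinate_system M U x" and V: "V \<subseteq> U"
  shows "tangent_coords x ` tangent_over M V = x ` V \<times> UNIV"
proof (intro equalityI subsetI)
  fix z assume "z \<in> x ` V \<times> (UNIV :: 'b set)"
  then obtain p a where p: "p \<in> V" "z = (x p, a)" by auto
  then have "z = tangent_coords x (p, coord_vector M U x p a)" "(p, coord_vector M U x p a) \<in> tangent_over M V"
    using V vec_coords_coord_vector[OF M x] coord_vector_tangent[OF M x]
    by (auto simp: tangent_coords_def tangent_over_def)
  then show "z \<in> tangent_coords x ` tangent_over M V" by blast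
qed (auto simp: tangent_coords_def tangent_over_def)

lemma inv_into_tangent_coords:
  assumes M: "smooth_atlas M" and x: "coordinate_system M U x" and p: "p \<in> U"
  shows "inv_into (tangent_over M U) (tangent_coords x) (x p, a) = (p, coord_vector M U x p a)"
  by (rule inv_into_f_eq[OF inj_on_tangent_coords[OF M x]])
    (use p in \<open>auto simp: tangent_over_def tangent_coords_def coord_vector_tangent[OF M x]
       vec_coords_coord_vector[OF M x]\<close>)

text \<open>The change of bundle coordinates sends \<open>(z, a)\<close> to the value of
  \<open>?\<tau>\<close> at \<open>z\<close> and its derivative there along \<open>a\<close>;
  smoothness of the second part is \<open>smooth_on_tangent_map\<close>.\<close>

lemma smooth_on_tangent_transition:
  assumes M: "smooth_atlas M" and x: "coordinate_system M U x" and y: "coordinate_system M V y"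
    and c: "compatible (U, x) (V, y)"
  shows "smooth_on (\<lambda>z. tangent_coords y (inv_into (tangent_over M U) (tangent_coords x) z))
    (tangent_coords x ` (tangent_over M U \<inter> tangent_over M V))"
proof -
  let ?\<tau> = "\<lambda>z. y (inv_into U x z)" and ?S = "x ` (U \<inter> V)"
  have S: "open ?S" and \<tau>: "smooth_on ?\<tau> ?S" using c by (auto simp: compatible_def)
  have oS: "open (?S \<times> (UNIV :: 'b set))" using S by (simp add: open_Times)
  have img: "tangent_coords x ` (tangent_over M U \<inter> tangent_over M V) = ?S \<times> UNIV"
    by (simp add: tangent_over_Int tangent_coords_image[OF M x])
  have vc: "vec_coords y (coord_vector M U x p a) = frechet_derivative ?\<tau> (at (x p)) a"
    if p: "p \<in> U" "p \<in> V" for p a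
  proof -
    have "coord_vector M U x p a (\<lambda>q. y q \<bullet> b) = frechet_derivative ?\<tau> (at (x p)) a \<bullet> b" for b
      using p smooth_fun_imp_near[OF smooth_fun_coordinate[OF M y]]
      by (intro coord_vector_eqI[OF M x] bounded_linear.has_derivative[OF bounded_linear_inner_left]
          smooth_on_has_derivative[OF \<tau>]) auto
    then show ?thesis by (simp add: vec_coords_def euclidean_representation)
  qed
  have "smooth_on (\<lambda>z. (?\<tau> (fst z), (\<lambda>(x, v). frechet_derivative ?\<tau> (at x) v) z)) (?S \<times> UNIV)"
    by (intro smooth_on_Pair oS smooth_on_tangent_map[OF S \<tau>] smooth_on_compose[OF oS _ \<tau>]
        smooth_on_bounded_linear bounded_linear_fst) auto
  then show ?thesis unfolding img
    by (rule smooth_on_cong[OF oS, rotated])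
      (auto simp: inv_into_tangent_coords[OF M x] coordinate_system_inv[OF x] vc tangent_coords_Pair)
qed

lemma compatible_tangent_chart:
  assumes M: "smooth_atlas M" and x: "coordinate_system M U x" and y: "coordinate_system M V y"
    and c: "compatible (U, x) (V, y)"
  shows "compatible (tangent_chart M (U, x)) (tangent_chart M (V, y))"
proof -
  have "compatible (V, y) (U, x)" using c by (simp add: compatible_commute)
  moreover have "open (tangent_coords x ` tangent_over M (U \<inter> V))" "open (tangent_coords y ` tangent_over M (U \<inter> V))"
    using c by (simp_all add: tangent_coords_image[OF M x] tangent_coords_image[OF M y] compatible_def open_Times)
  ultimately show ?thesis
    using smooth_on_tangent_transition[OF M x y c] smooth_on_tangent_transition[OF M y x]
    unfolding tangent_chart_eq compatible_def by (simp add: tangent_over_Int Int_commute)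
qed

lemma smooth_atlas_tangent_bundle:
  assumes M: "smooth_atlas M"
  shows "smooth_atlas (tangent_bundle M)"
proof -
  have "inj_on (tangent_coords \<phi>) (tangent_over M U)" "open (tangent_coords \<phi> ` tangent_over M U)"
    if "(U, \<phi>) \<in> M" for U \<phi>
    using coordinate_system_chart[OF M that] inj_on_tangent_coords[OF M]
    by (auto simp: tangent_coords_image[OF M] coordinate_systemD(3) open_Times)
  moreover have "compatible (tangent_chart M c) (tangent_chart M d)" if "c \<in> M" "d \<in> M" for c d
    using M that by (cases c, cases d)
      (auto intro!: compatible_tangent_chart[OF M] coordinate_system_chart[OF M] simp: smooth_atlas_def)
  ultimately show ?thesis
    by (auto simp: smooth_atlas_def tangent_bundle_def tangent_chart_eq)
qed

text \<open>Brings the bundle under the preceding coordinate calculus, with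
  \<open>tangent_bundle M\<close> in the role of the manifold.\<close>

lemma coordinate_system_tangent_bundle:
  assumes M: "smooth_atlas M" and x: "coordinate_system M U x"
  shows "coordinate_system (tangent_bundle M) (tangent_over M U) (tangent_coords x)"
proof -
  have comp: "compatible (tangent_over M U, tangent_coords x) c" if cN: "c \<in> tangent_bundle M" for c
  proof -
    obtain V \<psi> where c: "(V, \<psi>) \<in> M" "c = tangent_chart M (V, \<psi>)"
      using cN by (auto simp: tangent_bundle_def)
    then have "compatible (U, x) (V, \<psi>)" using x by (auto simp: coordinate_system_def)
    from compatible_tangent_chart[OF M x coordinate_system_chart[OF M c(1)] this]
    show ?thesis by (simp add: c tangent_chart_eq)
  qed
  have "open (\<psi> ` (V \<inter> tangent_over M U))" if "(V, \<psi>) \<in> tangent_bundle M" for V \<psi>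
    using comp[OF that] by (auto simp: compatible_def Int_commute)
  moreover have "tangent_over M U \<subseteq> carrier_of (tangent_bundle M)"
    using coordinate_systemD(1)[OF x] by (auto simp: carrier_of_tangent_bundle tangent_over_def open_set_def)
  moreover have "open (tangent_coords x ` tangent_over M U)"
    using coordinate_systemD(3)[OF x] by (simp add: tangent_coords_image[OF M x] open_Times)
  ultimately show ?thesis
    using comp inj_on_tangent_coords[OF M x] by (auto simp: coordinate_system_def open_set_def)
qed

text \<open>The chain rule for the coordinate expression \<open>G\<close> of \<open>F\<close>.
  Control of \<open>F\<close> near \<open>p\<close> is enough, which admits sections over an open
  set.\<close>

lemma push_forward_coord_vector:
  assumes M: "smooth_atlas M" and x: "coordinate_system M U x" and p: "p \<in> U"
    and N: "smooth_atlas N" and y: "coordinate_system N V y"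
    and T: "open T" "x p \<in> T" "T \<subseteq> x ` U" and G: "smooth_on G T" "(G has_derivative D) (at (x p))"
    and F: "\<And>z. z \<in> T \<Longrightarrow> F (inv_into U x z) \<in> V" "\<And>z. z \<in> T \<Longrightarrow> y (F (inv_into U x z)) = G z"
  shows "push_forward M N F p (coord_vector M U x p a) = coord_vector N V y (F p) (D a)"
proof
  fix f
  show "push_forward M N F p (coord_vector M U x p a) f = coord_vector N V y (F p) (D a) f"
  proof (cases "smooth_near N (F p) f")
    case True
    note xinv = coordinate_system_inv[OF x p]
    have FV: "F p \<in> V" and Fp: "y (F p) = G (x p)" using F[OF T(2)] by (simp_all add: xinv)
    obtain S where S: "open S" "y (F p) \<in> S" "S \<subseteq> y ` V" "smooth_on (\<lambda>z. f (inv_into V y z)) S"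
      using smooth_near_coordinates[OF N y FV True] .
    let ?T = "T \<inter> G -` S"
    have oT: "open ?T"
      using smooth_on_imp_continuous_on[OF G(1)] T(1) S(1) by (rule continuous_open_preimage)
    have eq: "f (inv_into V y (G z)) = f (F (inv_into U x z))" if "z \<in> ?T" for z
      using F[of z] that coordinate_system_inv[OF y, of "F (inv_into U x z)"] by auto
    have "smooth_on (\<lambda>z. f (inv_into V y (G z))) ?T"
      by (rule smooth_on_compose[OF oT smooth_on_subset[OF G(1)] S(4)]) auto
    then have "smooth_on (\<lambda>z. f (F (inv_into U x z))) ?T"
      by (rule smooth_on_cong[OF oT, rotated]) (rule eq)
    \<comment> \<open>Guards against the default value: a tangent vector returns \<open>0\<close> on
      functions that are not smooth near \<open>p\<close>.\<close>
    then have sn: "smooth_near M p (\<lambda>q. f (F q))"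
      using T S(2) Fp by (intro smooth_nearI[OF M x p oT]) auto
    have "((\<lambda>z. f (inv_into V y (G z))) has_derivative (\<lambda>a. coord_vector N V y (F p) (D a) f)) (at (x p))"
      using has_derivative_compose[OF G(2)] smooth_near_has_derivative[OF N y FV True] Fp by fastforce
    then have "((\<lambda>z. f (F (inv_into U x z))) has_derivative (\<lambda>a. coord_vector N V y (F p) (D a) f)) (at (x p))"
      by (rule has_derivative_transform_within_open[OF _ oT]) (use eq T(2) S(2) Fp in auto)
    then have "coord_vector M U x p a (\<lambda>q. f (F q)) = coord_vector N V y (F p) (D a) f"
      by (rule coord_vector_eqI[OF M x p sn])
    then show ?thesis using True by (simp add: push_forward_def)
  qed (simp add: push_forward_def coord_vector_def)
qed

lemma d_pi_coord_vector:
  assumes M: "smooth_atlas M" and x: "coordinate_system M U x" and u: "u \<in> tangent_over M U"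
  shows "d_pi M u (coord_vector (tangent_bundle M) (tangent_over M U) (tangent_coords x) u (a, b)) =
    coord_vector M U x (fst u) a"
proof -
  note X = coordinate_system_tangent_bundle[OF M x]
  have img: "tangent_coords x ` tangent_over M U = x ` U \<times> UNIV" by (simp add: tangent_coords_image[OF M x])
  have o: "open (x ` U \<times> (UNIV :: 'b set))" using coordinate_systemD(3)[OF x] by (simp add: open_Times)
  show ?thesis unfolding d_pi_def
  proof (subst push_forward_coord_vector[OF smooth_atlas_tangent_bundle[OF M] X u M x o, where G = fst and D = fst])
    show "tangent_coords x u \<in> x ` U \<times> UNIV" using u by (auto simp: tangent_over_def tangent_coords_def)
    show "smooth_on fst (x ` U \<times> (UNIV :: 'b set))" by (intro smooth_on_bounded_linear o bounded_linear_fst)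
    show "(fst has_derivative fst) (at (tangent_coords x u))"
      by (intro bounded_linear_imp_has_derivative bounded_linear_fst)
  qed (auto simp: img inv_into_tangent_coords[OF M x] )
qed

text \<open>In coordinates the section is the graph of the components of \<open>Y\<close>.
  Prescribing their first derivative thus prescribes the fibre part of the push-forward.\<close>

lemma push_forward_section:
  assumes M: "smooth_atlas M" and x: "coordinate_system M U x" and p: "p \<in> U" "p \<in> W"
    and Y: "vector_field M W Y"
  shows "push_forward M (tangent_bundle M) (\<lambda>q. (q, Y q)) p (coord_vector M U x p a) =
    coord_vector (tangent_bundle M) (tangent_over M U) (tangent_coords x) (p, Y p)
      (a, frechet_derivative (\<lambda>z. vec_coords x (Y (inv_into U x z))) (at (x p)) a)"
proof (rule push_forward_coord_vector[OF M x p(1) smooth_atlas_tangent_bundle[OF M]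
      coordinate_system_tangent_bundle[OF M x], where T = "x ` (U \<inter> W)"
      and G = "\<lambda>z. (z, vec_coords x (Y (inv_into U x z)))"])
  note YD = vector_fieldD[OF Y]
  note s = smooth_on_vector_field_coords[OF M x Y]
  show o: "open (x ` (U \<inter> W))" by (rule open_coordinate_image[OF M x YD(1)])
  show "smooth_on (\<lambda>z. (z, vec_coords x (Y (inv_into U x z)))) (x ` (U \<inter> W))"
    by (intro smooth_on_Pair o s smooth_on_bounded_linear bounded_linear_ident)
  show "((\<lambda>z. (z, vec_coords x (Y (inv_into U x z)))) has_derivative
    (\<lambda>a. (a, frechet_derivative (\<lambda>z. vec_coords x (Y (inv_into U x z))) (at (x p)) a))) (at (x p))"
    using p by (intro has_derivative_Pair has_derivative_ident smooth_on_has_derivative[OF s]) auto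
  fix z assume "z \<in> x ` (U \<inter> W)"
  then obtain q where q: "q \<in> U" "q \<in> W" "z = x q" by auto
  then show "(inv_into U x z, Y (inv_into U x z)) \<in> tangent_over M U"
    "tangent_coords x (inv_into U x z, Y (inv_into U x z)) = (z, vec_coords x (Y (inv_into U x z)))"
    using YD(2) by (auto simp: coordinate_system_inv[OF x] tangent_over_def tangent_coords_def)
qed (use p in auto)

section \<open>The connector in affine coordinates\<close>

lemma smooth_fun_add:
  "smooth_fun M W f \<Longrightarrow> smooth_fun M W g \<Longrightarrow> smooth_fun M W (\<lambda>p. f p + g p)"
  by (auto simp: smooth_fun_def open_set_def intro!: smooth_on_add)

lemma add_in_tangent_space:
  assumes M: "smooth_atlas M" and p: "p \<in> carrier_of M" and v: "v \<in> tangent_space M p" "w \<in> tangent_space M p"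
  shows "v + w \<in> tangent_space M p"
proof -
  obtain V \<psi> where c: "(V, \<psi>) \<in> M" "p \<in> V" using p by (rule obtain_chart)
  note cs = coordinate_system_chart[OF M c(1)]
  obtain a b where "v = coord_vector M V \<psi> p a" "w = coord_vector M V \<psi> p b"
    using v tangent_space_eq_range[OF M cs c(2)] by blast
  then have "v + w = coord_vector M V \<psi> p (a + b)"
    using coord_vector_linear[OF M cs c(2), of 1 a 1 b] by (simp add: scale_def)
  then show ?thesis using coord_vector_tangent[OF M cs c(2)] by simp
qed

lemma global_field_zero:
  assumes M: "smooth_atlas M"
  shows "global_field M (\<lambda>q. 0)"
  unfolding vector_field_def
  by (auto simp: open_set_carrier[OF M] zero_in_tangent_space[OF M] smooth_fun_const smooth_fun_def smooth_on_const)

lemma global_field_add: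
  assumes M: "smooth_atlas M" and X: "global_field M X" "global_field M Y"
  shows "global_field M (\<lambda>q. X q + Y q)"
  unfolding vector_field_def
proof (intro conjI allI ballI impI; (elim conjE)?)
  fix p assume "p \<in> carrier_of M"
  then show "X p + Y p \<in> tangent_space M p"
    using vector_fieldD(2)[OF X(1)] vector_fieldD(2)[OF X(2)] add_in_tangent_space[OF M] by blast
next
  fix V f assume "V \<subseteq> carrier_of M" "smooth_fun M V f"
  then show "smooth_fun M V (\<lambda>p. (X p + Y p) f)"
    using vector_fieldD(4)[OF X(1)] vector_fieldD(4)[OF X(2)] by (simp add: smooth_fun_add)
qed (use vector_fieldD(3)[OF X(1)] vector_fieldD(3)[OF X(2)] open_set_carrier[OF M] in auto)

lemma global_field_scale:
  assumes M: "smooth_atlas M" and f: "smooth_fun M (carrier_of M) f" and X: "global_field M X"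
  shows "global_field M (\<lambda>q. f q \<cdot> X q)"
  unfolding vector_field_def
proof (intro conjI allI ballI impI; (elim conjE)?)
  fix p assume "p \<in> carrier_of M"
  then show "f p \<cdot> X p \<in> tangent_space M p"
    using vector_fieldD(2)[OF X] scale_in_tangent_space[OF M] by blast
next
  fix p assume "p \<notin> carrier_of M"
  then have "X p = 0" by (rule vector_fieldD(3)[OF X])
  then show "f p \<cdot> X p = 0" by (simp add: scale_def zero_fun_def)
next
  fix V g assume V: "V \<subseteq> carrier_of M" and g: "smooth_fun M V g"
  then have "open_set M V" by (simp add: smooth_fun_def)
  with V g show "smooth_fun M V (\<lambda>p. (f p \<cdot> X p) g)"
    unfolding scale_def
    by (intro smooth_fun_mult vector_fieldD(4)[OF X] smooth_fun_subset[OF M f])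
qed (rule open_set_carrier[OF M])

lemma global_field_sum:
  assumes M: "smooth_atlas M" and "finite J" "\<And>j. j \<in> J \<Longrightarrow> global_field M (Y j)"
  shows "global_field M (\<lambda>q. \<Sum>j\<in>J. Y j q)"
  using assms(2,3) by (induction J) (auto intro: global_field_zero[OF M] global_field_add[OF M])

lemma affine_connection_sum:
  assumes M: "smooth_atlas M" and nabla: "affine_connection M nabla" and X: "global_field M X"
    and "finite J" "\<And>j. j \<in> J \<Longrightarrow> global_field M (Y j)"
  shows "nabla X (\<lambda>q. \<Sum>j\<in>J. Y j q) p = (\<Sum>j\<in>J. nabla X (Y j) p)"
proof -
  have add: "nabla X (Y + Y') = nabla X Y + nabla X Y'" if "global_field M Y" "global_field M Y'" for Y Y'
    using nabla X that by (simp add: affine_connection_def)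
  have z: "(\<lambda>q. 0) = (0 :: 'a \<Rightarrow> 'a tvec)" by (simp add: zero_fun_def)
  from assms(4,5) show ?thesis
  proof (induction J)
    case empty
    \<comment> \<open>The empty sum: additivity makes \<open>nabla X 0\<close> equal to twice
      itself.\<close>
    have "nabla X (0 + 0) = nabla X 0 + nabla X 0"
      using global_field_zero[OF M] unfolding z by (intro add)
    then have "nabla X 0 + 0 = nabla X 0 + nabla X 0" by simp
    then have "nabla X 0 f g = 0" for f g by (simp only: plus_fun_def fun_eq_iff zero_fun_def) simp
    then show ?case by (simp add: z fun_eq_iff zero_fun_def)
  next
    case (insert j J)
    have "(\<lambda>q. \<Sum>j\<in>insert j J. Y j q) = Y j + (\<lambda>q. \<Sum>j\<in>J. Y j q)"
      using insert.hyps by (simp add: plus_fun_def)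
    then show ?case using insert add[of "Y j" "\<lambda>q. \<Sum>j\<in>J. Y j q"] global_field_sum[OF M, of J Y]
      by (simp add: plus_fun_def)
  qed
qed

text \<open>Locality needs no bump functions once a connector is given: the push-forward along the
  section depends on \<open>X p\<close> and the germ of \<open>Y\<close> only, and \<open>K\<close>
  turns it into the value of \<open>nabla\<close>.\<close>

lemma connector_local:
  assumes M: "smooth_atlas M" and K: "connector M nabla K"
    and X: "global_field M X" "global_field M X'" "global_field M Y" "global_field M Y'"
    and W: "open_set M W" "p \<in> W" "\<And>q. q \<in> W \<Longrightarrow> X q = X' q \<and> Y q = Y' q"
  shows "nabla X Y p = nabla X' Y' p"
proof -
  have p: "p \<in> carrier_of M" using W by (auto simp: open_set_def)
  have "push_forward M (tangent_bundle M) (\<lambda>q. (q, Y q)) p (X p) =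
      push_forward M (tangent_bundle M) (\<lambda>q. (q, Y' q)) p (X' p)"
  proof
    fix f
    have "X p (\<lambda>q. f (q, Y q)) = X p (\<lambda>q. f (q, Y' q))"
      by (rule tangent_vector_germ[OF M vector_fieldD(2)[OF X(1) p] W(1,2)]) (simp add: W(3))
    then show "push_forward M (tangent_bundle M) (\<lambda>q. (q, Y q)) p (X p) f =
        push_forward M (tangent_bundle M) (\<lambda>q. (q, Y' q)) p (X' p) f"
      using W by (simp add: push_forward_def)
  qed
  moreover have "nabla X Y p = K (p, Y p) (push_forward M (tangent_bundle M) (\<lambda>q. (q, Y q)) p (X p))"
    "nabla X' Y' p = K (p, Y' p) (push_forward M (tangent_bundle M) (\<lambda>q. (q, Y' q)) p (X' p))"
    using K X p by (auto simp: connector_def)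
  ultimately show ?thesis using W by simp
qed

text \<open>By locality all admissible global extensions give the same value, so the definite
  description in \<open>local_nabla\<close> denotes it.\<close>

lemma local_nabla_eq:
  assumes M: "smooth_atlas M" and K: "connector M nabla K"
    and X: "global_field M X'" "global_field M Y'"
    and W: "open_set M W" "p \<in> W" "\<And>q. q \<in> W \<Longrightarrow> X' q = X q \<and> Y' q = Y q"
  shows "local_nabla M nabla X Y p = nabla X' Y' p"
  unfolding local_nabla_def
proof (rule the_equality)
  show "\<exists>X'' Y'' W. global_field M X'' \<and> global_field M Y'' \<and> open_set M W \<and> p \<in> W \<and>
      (\<forall>q\<in>W. X'' q = X q \<and> Y'' q = Y q) \<and> nabla X' Y' p = nabla X'' Y'' p"
    using assms by blast
next
  fix v assume "\<exists>X'' Y'' W. global_field M X'' \<and> global_field M Y'' \<and> open_set M W \<and> p \<in> W \<and>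
      (\<forall>q\<in>W. X'' q = X q \<and> Y'' q = Y q) \<and> v = nabla X'' Y'' p"
  then obtain X'' Y'' W' where 1: "global_field M X''" "global_field M Y''" "open_set M W'" "p \<in> W'"
      "\<And>q. q \<in> W' \<Longrightarrow> X'' q = X q \<and> Y'' q = Y q" "v = nabla X'' Y'' p" by blast
  have "nabla X'' Y'' p = nabla X' Y' p"
    by (rule connector_local[OF M K 1(1) X(1) 1(2) X(2) open_set_Int[OF M W(1) 1(3)]])
      (use W 1 in auto)
  then show "v = nabla X' Y' p" using 1(6) by simp
qed

lemma vec_coords_linear:
  "vec_coords x (s \<cdot> v + t \<cdot> w) = s *\<^sub>R vec_coords x v + t *\<^sub>R vec_coords x w"
  by (simp add: vec_coords_def scale_def scaleR_sum_right sum.distrib scaleR_add_left)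

lemma axis_cart_inner: "(v :: real^'n) \<bullet> axis k 1 = v $ k"
  by (simp add: inner_axis)

lemma coord_vector_sum_axis:
  fixes x :: "'a \<Rightarrow> real^'n"
  assumes M: "smooth_atlas M" and x: "coordinate_system M U x" and p: "p \<in> U"
  shows "(\<Sum>j\<in>UNIV. b $ j \<cdot> coord_vector M U x p (axis j 1)) = coord_vector M U x p b"
proof
  fix f
  have sum_apply: "(\<Sum>j\<in>J. v j) f = (\<Sum>j\<in>J. v j f)" for J and v :: "'n \<Rightarrow> 'a tvec"
    by (induction J rule: infinite_finite_induct) auto
  show "(\<Sum>j\<in>UNIV. b $ j \<cdot> coord_vector M U x p (axis j 1)) f = coord_vector M U x p b f"
  proof (cases "smooth_near M p f")
    case True
    have l: "linear (\<lambda>a. coord_vector M U x p a f)"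
      by (rule has_derivative_linear[OF smooth_near_has_derivative[OF M x p True]])
    have "coord_vector M U x p (\<Sum>j\<in>UNIV. b $ j *\<^sub>R axis j 1) f =
        (\<Sum>j\<in>UNIV. b $ j * coord_vector M U x p (axis j 1) f)"
      by (simp add: linear_sum[OF l] linear_cmul[OF l])
    moreover have "(\<Sum>j\<in>UNIV. b $ j *\<^sub>R axis j 1) = b"
      using basis_expansion[of b] by (simp add: scalar_mult_eq_scaleR)
    ultimately show ?thesis by (simp add: sum_apply scale_def)
  qed (simp add: sum_apply scale_def coord_vector_def)
qed

text \<open>The vector field with coordinates \<open>z \<mapsto> v + (z - x(p))\<^sub>i b\<close>, cut off outside \<open>U\<close>, passes
  through \<open>v\<close> at \<open>p\<close> with derivative \<open>b\<close> in direction \<open>\<partial>/\<partial>x\<^sub>i\<close>.\<close>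

lemma connector_coord_vector_axis:
  fixes x :: "'a \<Rightarrow> real^'n"
  assumes man: "smooth_manifold M" and nabla: "affine_connection M nabla" and K: "connector M nabla K"
    and aff: "affine_coordinates M nabla U x" and p: "p \<in> U"
  shows "K (p, coord_vector M U x p v) (coord_vector (tangent_bundle M) (tangent_over M U) (tangent_coords x)
    (p, coord_vector M U x p v) (axis i 1, b)) = coord_vector M U x p b"
proof -
  have M: "smooth_atlas M" using man by (simp add: smooth_manifold_def)
  have x: "coordinate_system M U x" using aff by (simp add: affine_coordinates_def)
  have U: "open_set M U" by (rule coordinate_systemD(1)[OF x])
  obtain A \<rho> where \<rho>: "cutoff M U A \<rho>" and pA: "p \<in> A" using ex_cutoff[OF man x p] by blast
  have A: "open_set M A" "A \<subseteq> U" "\<And>q. q \<in> A \<Longrightarrow> \<rho> q = 1" using \<rho> by (auto simp: cutoff_def)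
  have pc: "p \<in> carrier_of M" using U p by (auto simp: open_set_def)
  \<comment> \<open>The coordinate frame, extended by \<open>0\<close>; multiplied by
    \<open>\<rho>\<close> it becomes the global frame \<open>E\<close>, equal to it on
    \<open>A\<close>.\<close>
  define D where "D j q = (if q \<in> U then coord_vector M U x q (axis j 1) else 0)" for j q
  define E where "E j q = \<rho> q \<cdot> D j q" for j q
  have "vector_field M U (D j)" for j
    by (rule vector_field_coordinatesI[OF M x U order_refl, where c = "\<lambda>z. axis j 1"])
      (auto simp: D_def smooth_on_const)
  then have E: "global_field M (E j)" for j
    unfolding E_def by (rule global_field_cutoff[OF M \<rho>])
  have EA: "E j q = coord_vector M U x q (axis j 1)" if "q \<in> A" for j q
    using that A by (auto simp: E_def D_def scale_def)
  have nablaE: "nabla (E j) (E k) p = 0" for j k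
  proof -
    \<comment> \<open>A vector can be recovered from its components, and so vanishes with them, only
      once it is known to be tangent.\<close>
    have tan: "nabla (E j) (E k) p \<in> tangent_space M p"
      using nabla E by (intro vector_fieldD(2)[OF _ pc]) (simp add: affine_connection_def)
    have "local_nabla M nabla (coord_field M U x j) (coord_field M U x k) p = nabla (E j) (E k) p"
      using A by (intro local_nabla_eq[OF M K E E A(1) pA]) (auto simp: EA coord_field_eq[OF M x])
    moreover have "christoffel M nabla U x j k l p = 0" for l
      using aff p by (auto simp: affine_coordinates_def)
    ultimately have "nabla (E j) (E k) p (\<lambda>q. x q $ l) = 0" for l
      by (simp add: christoffel_def)
    then have "vec_coords x (nabla (E j) (E k) p) = 0"
      by (auto simp: vec_coords_def Basis_vec_def axis_cart_inner intro!: sum.neutral)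
    then have "nabla (E j) (E k) p = coord_vector M U x p 0"
      using coord_vector_vec_coords[OF M x p tan] by simp
    also have "\<dots> = 0"
      using coord_vector_linear[OF M x p, of 0 0 0 0] by (simp add: scale_def zero_fun_def)
    finally show ?thesis .
  qed
  define l where "l j q = v $ j + (x q \<bullet> axis i 1 + - (x p $ i)) * b $ j" for j q
  \<comment> \<open>Extends the affine components to the whole manifold. \<open>Y\<close> thereby
    carries the factor \<open>\<rho>\<close> twice, which is harmless since it equals
    \<open>1\<close> on \<open>A\<close>.\<close>
  define c where "c j q = (if q \<in> U then \<rho> q * l j q else 0)" for j q
  have "smooth_fun M U (l j)" for j
    unfolding l_def by (intro smooth_fun_add smooth_fun_mult smooth_fun_const U smooth_fun_coordinate[OF M x])
  then have c: "smooth_fun M (carrier_of M) (c j)" for j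
    unfolding c_def by (rule smooth_fun_cutoff[OF M \<rho>])
  define Y where "Y q = (\<Sum>j\<in>UNIV. c j q \<cdot> E j q)" for q
  have Y: "global_field M Y"
    unfolding Y_def by (intro global_field_sum[OF M] global_field_scale[OF M] c E) auto
  have YA: "Y q = coord_vector M U x q (v + (x q - x p) $ i *\<^sub>R b)" if q: "q \<in> A" for q
  proof -
    have qU: "q \<in> U" using A q by auto
    have "c j q = (v + (x q - x p) $ i *\<^sub>R b) $ j" for j
      using qU A(3)[OF q] by (simp add: c_def l_def axis_cart_inner)
    then show ?thesis unfolding Y_def EA[OF q] by (simp only: coord_vector_sum_axis[OF M x qU])
  qed
  have Yp: "Y p = coord_vector M U x p v" using YA[OF pA] by simp
  have dc: "E i p (c j) = b $ j" for j
  proof -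
    have "E i p (c j) = coord_vector M U x p (axis i 1) (l j)"
      unfolding EA[OF pA] using A
      by (intro tangent_vector_germ[OF M coord_vector_tangent[OF M x p] A(1) pA]) (auto simp: c_def)
    also have "\<dots> = (axis i 1 \<bullet> (axis i 1 :: real^'n)) * b $ j"
    proof (rule coord_vector_eqI[OF M x p, where D = "\<lambda>a. (a \<bullet> axis i 1) * b $ j"])
      show "smooth_near M p (l j)" using \<open>smooth_fun M U (l j)\<close> p by (rule smooth_fun_imp_near)
      have "((\<lambda>z. v $ j + (z \<bullet> axis i 1 + - (x p $ i)) * b $ j) has_derivative
          (\<lambda>a. (a \<bullet> axis i 1) * b $ j)) (at (x p))"
        by (auto intro!: derivative_eq_intros)
      then show "((\<lambda>z. l j (inv_into U x z)) has_derivative (\<lambda>a. (a \<bullet> axis i 1) * b $ j)) (at (x p))"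
        unfolding l_def
        by (rule has_derivative_transform_within_open[of _ _ _ _ "x ` U"])
          (use coordinate_systemD[OF x] p in \<open>auto simp: coordinate_system_inv[OF x]\<close>)
    qed
    finally show ?thesis by (simp add: axis_cart_inner)
  qed
  \<comment> \<open>Leibniz rule in the frame \<open>E\<close>: the derivatives of the frame vanish
    at \<open>p\<close>, so only the derivatives of the components survive.\<close>
  have "nabla (E i) Y p = (\<Sum>j\<in>UNIV. nabla (E i) (\<lambda>q. c j q \<cdot> E j q) p)"
    unfolding Y_def by (rule affine_connection_sum[OF M nabla E]) (auto intro: global_field_scale[OF M] c E)
  also have "\<dots> = (\<Sum>j\<in>UNIV. E i p (c j) \<cdot> E j p + c j p \<cdot> nabla (E i) (E j) p)"
    using nabla E c by (simp add: affine_connection_def)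
  also have "\<dots> = (\<Sum>j\<in>UNIV. b $ j \<cdot> coord_vector M U x p (axis j 1))"
    unfolding nablaE dc unfolding EA[OF pA] by (simp add: scale_def plus_fun_def)
  also have "\<dots> = coord_vector M U x p b" by (rule coord_vector_sum_axis[OF M x p])
  finally have n: "nabla (E i) Y p = coord_vector M U x p b" .
  \<comment> \<open>The same derivative seen from the bundle: \<open>b\<close> is the fibre part of
    the push-forward of \<open>E i p\<close> along \<open>Y\<close>.\<close>
  have "((\<lambda>z. v + (z \<bullet> axis i 1 - x p $ i) *\<^sub>R b) has_derivative (\<lambda>a. (a \<bullet> axis i 1) *\<^sub>R b)) (at (x p))"
    by (auto intro!: derivative_eq_intros)
  then have "((\<lambda>z. vec_coords x (Y (inv_into U x z))) has_derivative (\<lambda>a. (a \<bullet> axis i 1) *\<^sub>R b)) (at (x p))"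
    by (rule has_derivative_transform_within_open[of _ _ _ _ "x ` (U \<inter> A)"])
      (use open_coordinate_image[OF M x A(1)] p pA in
        \<open>auto simp: coordinate_system_inv[OF x] YA vec_coords_coord_vector[OF M x] axis_cart_inner\<close>)
  from frechet_derivative_at[OF this, symmetric]
  have "frechet_derivative (\<lambda>z. vec_coords x (Y (inv_into U x z))) (at (x p)) (axis i 1) = b"
    by (simp add: axis_cart_inner)
  then have "push_forward M (tangent_bundle M) (\<lambda>q. (q, Y q)) p (E i p) =
    coord_vector (tangent_bundle M) (tangent_over M U) (tangent_coords x) (p, Y p) (axis i 1, b)"
    using push_forward_section[OF M x p pc Y, of "axis i 1"] by (simp add: EA[OF pA])
  moreover have "nabla (E i) Y p = K (p, Y p) (push_forward M (tangent_bundle M) (\<lambda>q. (q, Y q)) p (E i p))"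
    using K E Y pc by (auto simp: connector_def)
  ultimately show ?thesis using n Yp by simp
qed

text \<open>Extends the values on vectors \<open>(axis i 1, b)\<close> by linearity:
  \<open>b = 0\<close> settles the horizontal directions, and differences settle the vertical
  ones.\<close>

lemma connector_coord_vector:
  fixes x :: "'a \<Rightarrow> real^'n"
  assumes man: "smooth_manifold M" and nabla: "affine_connection M nabla" and K: "connector M nabla K"
    and aff: "affine_coordinates M nabla U x" and u: "u \<in> tangent_over M U"
  shows "K u (coord_vector (tangent_bundle M) (tangent_over M U) (tangent_coords x) u (a, b)) =
    coord_vector M U x (fst u) b"
proof -
  let ?N = "tangent_bundle M"
  let ?T = "coord_vector ?N (tangent_over M U) (tangent_coords x) u"
  have M: "smooth_atlas M" using man by (simp add: smooth_manifold_def)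
  have x: "coordinate_system M U x" using aff by (simp add: affine_coordinates_def)
  note N = smooth_atlas_tangent_bundle[OF M] and X = coordinate_system_tangent_bundle[OF M x]
  obtain p v where p: "p \<in> U" and u_eq: "u = (p, coord_vector M U x p v)"
    using u coord_vector_vec_coords[OF M x] by (auto simp: tangent_over_def) metis
  have uc: "u \<in> carrier_of ?N" using coordinate_systemD(1)[OF X] u by (auto simp: open_set_def)
  define \<kappa> where "\<kappa> c = vec_coords x (K u (?T c))" for c
  have tan: "?T c \<in> tangent_space ?N u" for c by (rule coord_vector_tangent[OF N X u])
  have \<kappa>: "\<kappa> (s *\<^sub>R c + t *\<^sub>R d) = s *\<^sub>R \<kappa> c + t *\<^sub>R \<kappa> d" for s t c d
    using K uc tan by (simp add: \<kappa>_def coord_vector_linear[OF N X u] connector_def vec_coords_linear)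
  have lin: "linear \<kappa>"
    using \<kappa>[of 1 _ 1] \<kappa>[of _ _ 0] by (intro linearI) simp_all
  have ax: "\<kappa> (axis i 1, b) = b" for i b
    using connector_coord_vector_axis[OF man nabla K aff p, of v i b]
    by (simp add: \<kappa>_def u_eq vec_coords_coord_vector[OF M x p])
  have "linear (\<lambda>a. \<kappa> (a, 0))"
    using linear_compose[OF _ lin, of "\<lambda>a. (a, 0)"] by (simp add: o_def linear_iff)
  then have "(\<lambda>a. \<kappa> (a, 0)) = (\<lambda>a. 0)"
    by (rule linear_eq_stdbasis[OF _ linear_zero]) (auto simp: Basis_vec_def ax)
  then have \<kappa>0: "\<kappa> (a, 0) = 0" for a by meson
  \<comment> \<open>A vertical vector as a difference of two vectors with equal base part; the index
    is arbitrary, so \<open>undefined\<close> serves.\<close>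
  have "\<kappa> (0, b) = b" using linear_diff[OF lin, of "(axis undefined 1, b)" "(axis undefined 1, 0)"]
    by (simp add: ax)
  then have "\<kappa> (a, b) = b" using linear_add[OF lin, of "(a, 0)" "(0, b)"] \<kappa>0 by simp
  moreover have "K u (?T (a, b)) \<in> tangent_space M p"
    using K uc tan unfolding connector_def u_eq by auto
  ultimately show ?thesis
    using coord_vector_vec_coords[OF M x p, of "K u (?T (a, b))"] by (simp add: \<kappa>_def u_eq)
qed

section \<open>Dombrowski's structure in affine coordinates\<close>

text \<open>In \<open>X (Y f) - Y (X f)\<close> the second derivatives of \<open>f\<close> cancel by
  symmetry. Since the components of \<open>X\<close> are constant, only the derivative of the
  components of \<open>Y\<close> along \<open>\<xi>\<close> is left.\<close>

lemma lie_bracket_constant_field: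
  assumes M: "smooth_atlas M" and x: "coordinate_system M U x" and p: "p \<in> U"
    and X: "vector_field M U X" "\<And>q. q \<in> U \<Longrightarrow> X q = coord_vector M U x q \<xi>" and Y: "vector_field M U Y"
  shows "lie_bracket M X Y p =
    coord_vector M U x p (frechet_derivative (\<lambda>z. vec_coords x (Y (inv_into U x z))) (at (x p)) \<xi>)"
proof
  fix f
  let ?c = "\<lambda>z. vec_coords x (Y (inv_into U x z))"
  let ?c' = "frechet_derivative ?c (at (x p))"
  show "lie_bracket M X Y p f = coord_vector M U x p (?c' \<xi>) f"
  proof (cases "smooth_near M p f")
    case True
    obtain W where W: "p \<in> W" "W \<subseteq> U" "open_set M W" "smooth_fun M W f"
      using smooth_near_within[OF M True coordinate_systemD(1)[OF x] p] .
    let ?T = "x ` (U \<inter> W)" and ?f = "\<lambda>z. f (inv_into U x z)"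
    let ?D = "\<lambda>a z. frechet_derivative ?f (at z) a"
    let ?H = "\<lambda>a. frechet_derivative (?D a) (at (x p))"
    have T: "open ?T" "x p \<in> ?T" using W p open_coordinate_image[OF M x] by auto
    have f: "smooth_on ?f ?T" by (rule smooth_fun_coordinates[OF M x W(4)])
    have fd: "?f differentiable (at z)" if "z \<in> ?T" for z using f that by (rule smooth_on_differentiable)
    have c: "smooth_on ?c (x ` U)" using smooth_on_vector_field_coords[OF M x Y] by simp
    have cd: "(?c has_derivative ?c') (at (x p))" using p by (intro smooth_on_has_derivative[OF c]) auto
    have Dd: "(?D a has_derivative ?H a) (at (x p))" for a
      by (rule smooth_on_has_derivative[OF smooth_on_derivative[OF T(1) f] T(2)])
    have val: "coord_vector M U x q a f = ?D a (x q)" if "q \<in> W" for q a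
      using smooth_fun_imp_near[OF W(4) that] by (simp add: coord_vector_def)
    have Yval: "Y q f = (\<Sum>b\<in>Basis. (?c (x q) \<bullet> b) * ?D b (x q))" if q: "q \<in> W" for q
    proof -
      have qU: "q \<in> U" using q W by auto
      have "Y q = coord_vector M U x q (?c (x q))"
        using coord_vector_vec_coords[OF M x qU vector_fieldD(2)[OF Y qU]]
        by (simp add: coordinate_system_inv[OF x qU])
      then have "Y q f = ?D (?c (x q)) (x q)" using val[OF q] by simp
      also have "\<dots> = (\<Sum>b\<in>Basis. (?c (x q) \<bullet> b) *\<^sub>R ?D b (x q))"
        by (rule frechet_derivative_euclidean[OF fd]) (use q qU in auto)
      finally show ?thesis by simp
    qed
    have snY: "smooth_near M p (\<lambda>q. Y q f)"
      by (rule smooth_fun_imp_near[OF vector_fieldD(4)[OF Y W(2,4)] W(1)])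
    have snX: "smooth_near M p (\<lambda>q. X q f)"
      by (rule smooth_fun_imp_near[OF vector_fieldD(4)[OF X(1) W(2,4)] W(1)])
    have "((\<lambda>z. \<Sum>b\<in>Basis. (?c z \<bullet> b) * ?D b z) has_derivative
        (\<lambda>a. \<Sum>b\<in>Basis. (?c (x p) \<bullet> b) * ?H b a + (?c' a \<bullet> b) * ?D b (x p))) (at (x p))"
      by (intro has_derivative_sum has_derivative_mult Dd bounded_linear.has_derivative[OF bounded_linear_inner_left] cd)
    then have "((\<lambda>z. Y (inv_into U x z) f) has_derivative
        (\<lambda>a. \<Sum>b\<in>Basis. (?c (x p) \<bullet> b) * ?H b a + (?c' a \<bullet> b) * ?D b (x p))) (at (x p))"
      by (rule has_derivative_transform_within_open[OF _ T]) (auto simp: Yval coordinate_system_inv[OF x])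
    from coord_vector_eqI[OF M x p snY this, of \<xi>]
    have 1: "X p (\<lambda>q. Y q f) = (\<Sum>b\<in>Basis. (?c (x p) \<bullet> b) * ?H b \<xi>) + (\<Sum>b\<in>Basis. (?c' \<xi> \<bullet> b) * ?D b (x p))"
      using X(2)[OF p] by (simp add: sum.distrib)
    have "((\<lambda>z. X (inv_into U x z) f) has_derivative ?H \<xi>) (at (x p))"
      by (rule has_derivative_transform_within_open[OF Dd T])
        (use W in \<open>auto simp: X(2) val coordinate_system_inv[OF x]\<close>)
    from coord_vector_eqI[OF M x p snX this]
    have "coord_vector M U x p (?c (x p)) (\<lambda>q. X q f) = ?H \<xi> (?c (x p))" .
    moreover have "coord_vector M U x p (?c (x p)) = Y p"
      using coord_vector_vec_coords[OF M x p vector_fieldD(2)[OF Y p]] by (simp add: coordinate_system_inv[OF x p])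
    moreover have "?H \<xi> (?c (x p)) = (\<Sum>b\<in>Basis. (?c (x p) \<bullet> b) *\<^sub>R ?H \<xi> b)"
      using Dd by (intro frechet_derivative_euclidean) (auto simp: differentiable_def)
    moreover have "?H \<xi> b = ?H b \<xi>" for b
      by (rule symmetric_second_derivative[OF f T])
    ultimately have 2: "Y p (\<lambda>q. X q f) = (\<Sum>b\<in>Basis. (?c (x p) \<bullet> b) * ?H b \<xi>)" by simp
    have "?D (?c' \<xi>) (x p) = (\<Sum>b\<in>Basis. (?c' \<xi> \<bullet> b) *\<^sub>R ?D b (x p))"
      by (rule frechet_derivative_euclidean[OF fd[OF T(2)]])
    then show ?thesis using 1 2 True val[OF W(1)] by (simp add: lie_bracket_def)
  qed (simp add: lie_bracket_def coord_vector_def)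
qed

section \<open>The metric in coordinates and its Lie derivative along the fibres\<close>

definition metric_coords :: "('a, 'e::euclidean_space) atlas \<Rightarrow> 'a tensor2 \<Rightarrow> 'a set \<Rightarrow> ('a \<Rightarrow> 'e) \<Rightarrow>
    'a \<Rightarrow> 'e \<Rightarrow> 'e \<Rightarrow> real" where
  "metric_coords M h U x p a b = h p (coord_vector M U x p a) (coord_vector M U x p b)"

lemma bilinear_metric_coords:
  assumes M: "smooth_atlas M" and x: "coordinate_system M U x" and p: "p \<in> U"
    and h: "riemannian_metric M h"
  shows "bilinear (metric_coords M h U x p)"
proof -
  let ?v = "coord_vector M U x p" and ?H = "metric_coords M h U x p"
  have pc: "p \<in> carrier_of M" using coordinate_systemD(1)[OF x] p by (auto simp: open_set_def)
  have tan: "?v a \<in> tangent_space M p" for a by (rule coord_vector_tangent[OF M x p])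
  have sym: "?H a b = ?H b a" for a b
    using h pc tan by (simp add: riemannian_metric_def metric_coords_def)
  have l: "?H (s *\<^sub>R a + t *\<^sub>R b) c = s * ?H a c + t * ?H b c" for s t a b c
    using h pc tan by (simp add: riemannian_metric_def metric_coords_def coord_vector_linear[OF M x p])
  have l1: "linear (\<lambda>a. ?H a c)" for c
    using l[of 1 _ 1] l[of _ _ 0] by (intro linearI) simp_all
  then have "linear (\<lambda>c. ?H a c)" for a
    by (subst sym)
  with l1 show ?thesis by (simp add: bilinear_def)
qed

text \<open>Smoothness of a metric is postulated on pairs of vector fields; fields with constant
  components extract the coefficients.\<close>

lemma smooth_on_metric_coords:
  assumes M: "smooth_atlas M" and x: "coordinate_system M U x" and h: "riemannian_metric M h"
  shows "smooth_on (\<lambda>z. metric_coords M h U x (inv_into U x z) a b) (x ` U)"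
proof -
  note U = coordinate_systemD(1)[OF x]
  let ?X = "\<lambda>a p. if p \<in> U then coord_vector M U x p a else 0"
  have "vector_field M U (?X a)" for a
    by (rule vector_field_coordinatesI[OF M x U order_refl, where c = "\<lambda>z. a"]) (auto simp: smooth_on_const)
  then have "smooth_fun M U (\<lambda>p. h p (?X a p) (?X b p))"
    using h by (simp add: riemannian_metric_def)
  from smooth_fun_coordinates[OF M x this]
  have "smooth_on (\<lambda>z. h (inv_into U x z) (?X a (inv_into U x z)) (?X b (inv_into U x z))) (x ` U)" by simp
  then show ?thesis
    by (rule smooth_on_cong[OF coordinate_systemD(3)[OF x], rotated])
      (auto simp: metric_coords_def coordinate_system_inv[OF x])
qed

text \<open>The coefficients of the metric on the tangent bundle depend on the base point only, so a
  field with constant coordinates along the fibres is Killing.\<close>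

lemma lie_derivative_vertical:
  fixes M :: "('a, 'e::euclidean_space) atlas" and x :: "'a \<Rightarrow> 'e" and N
  defines "N \<equiv> tangent_bundle M"
  assumes M: "smooth_atlas M" and x: "coordinate_system M U x" and h: "riemannian_metric M h"
    and g: "\<And>u a b a' b'. u \<in> tangent_over M U \<Longrightarrow>
      g u (coord_vector N (tangent_over M U) (tangent_coords x) u (a, b))
          (coord_vector N (tangent_over M U) (tangent_coords x) u (a', b')) =
      metric_coords M h U x (fst u) a a' + metric_coords M h U x (fst u) b b'"
    and X: "vector_field N (tangent_over M U) X"
      "\<And>u. u \<in> tangent_over M U \<Longrightarrow> X u = coord_vector N (tangent_over M U) (tangent_coords x) u (0, w)"
    and Y: "vector_field N (tangent_over M U) Y" and Z: "vector_field N (tangent_over M U) Z"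
    and u: "u \<in> tangent_over M U"
  shows "lie_derivative2 N X g Y Z u = 0"
proof -
  let ?W = "tangent_over M U" and ?x = "tangent_coords x"
  let ?H = "metric_coords M h U x"
  note NA = smooth_atlas_tangent_bundle[OF M, folded N_def]
    and C = coordinate_system_tangent_bundle[OF M x, folded N_def]
  let ?v = "coord_vector N ?W ?x"
  let ?G = "\<lambda>p c d. ?H p (fst c) (fst d) + ?H p (snd c) (snd d)"
  let ?y = "\<lambda>z. vec_coords ?x (Y (inv_into ?W ?x z))" and ?z = "\<lambda>z. vec_coords ?x (Z (inv_into ?W ?x z))"
  have img: "?x ` ?W = x ` U \<times> UNIV" by (simp add: tangent_coords_image[OF M x])
  have o: "open (x ` U \<times> (UNIV :: 'e set))" using coordinate_systemD(3)[OF x] by (simp add: open_Times)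
  have gv: "g q (?v q c) (?v q d) = ?G (fst q) c d" if "q \<in> ?W" for q c d
    using g[OF that, of "fst c" "snd c" "fst d" "snd d"] by simp
  have fib: "fst q \<in> U" "?x q = (x (fst q), snd (?x q))" if "q \<in> ?W" for q
    using that by (auto simp: tangent_over_def tangent_coords_def)
  have Yv: "Y q = ?v q (?y (?x q))" and Zv: "Z q = ?v q (?z (?x q))" if "q \<in> ?W" for q
    using coord_vector_vec_coords[OF NA C that] vector_fieldD(2)[OF Y that] vector_fieldD(2)[OF Z that]
    by (simp_all add: coordinate_system_inv[OF C that])
  have y: "smooth_on ?y (x ` U \<times> UNIV)" and z: "smooth_on ?z (x ` U \<times> UNIV)"
    using smooth_on_vector_field_coords[OF NA C Y] smooth_on_vector_field_coords[OF NA C Z] by (simp_all add: img)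
  have bil: "bounded_bilinear (?H p)" if "p \<in> U" for p
    using bilinear_metric_coords[OF M x that h] by (simp add: bilinear_conv_bounded_bilinear)
  \<comment> \<open>The function obtained from \<open>g\<close>, \<open>Y\<close> and
    \<open>Z\<close>, in bundle coordinates; the base point is recovered from the first
    component.\<close>
  define F where "F z = ?G (inv_into U x (fst z)) (?y z) (?z z)" for z
  have F: "g q (Y q) (Z q) = F (?x q)" if "q \<in> ?W" for q
    using gv[OF that] Yv[OF that] Zv[OF that] fib[OF that] coordinate_system_inv[OF x, of "fst q"]
    by (metis F_def fst_conv)
  \<comment> \<open>The form varies with the base point, so it is expanded over the basis to reduce
    smoothness to that of its coefficients.\<close>
  have Hs: "smooth_on (\<lambda>z. ?H (inv_into U x (fst z)) (\<alpha> z) (\<beta> z)) (x ` U \<times> UNIV)"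
    if \<alpha>: "smooth_on \<alpha> (x ` U \<times> UNIV)" and \<beta>: "smooth_on \<beta> (x ` U \<times> UNIV)"
    for \<alpha> \<beta> :: "'e \<times> 'e \<Rightarrow> 'e"
  proof -
    have "smooth_on (\<lambda>z. \<Sum>b\<in>Basis. \<Sum>c\<in>Basis. (\<alpha> z \<bullet> b) * ((\<beta> z \<bullet> c) * ?H (inv_into U x (fst z)) b c)) (x ` U \<times> UNIV)"
      by (intro smooth_on_sum smooth_on_mult o smooth_on_inner \<alpha> \<beta>
          smooth_on_compose[OF o _ smooth_on_metric_coords[OF M x h], of fst]
          smooth_on_bounded_linear bounded_linear_fst) auto
    then show ?thesis
    proof (rule smooth_on_cong[OF o, rotated])
      fix z :: "'e \<times> 'e" assume "z \<in> x ` U \<times> UNIV"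
      then have "inv_into U x (fst z) \<in> U" by (auto simp: inv_into_into)
      then have B: "bilinear (?H (inv_into U x (fst z)))" by (rule bilinear_metric_coords[OF M x _ h])
      have "?H (inv_into U x (fst z)) (\<alpha> z) (\<beta> z) =
          ?H (inv_into U x (fst z)) (\<Sum>b\<in>Basis. (\<alpha> z \<bullet> b) *\<^sub>R b) (\<Sum>c\<in>Basis. (\<beta> z \<bullet> c) *\<^sub>R c)"
        by (simp add: euclidean_representation)
      also have "\<dots> = (\<Sum>b\<in>Basis. \<Sum>c\<in>Basis. (\<alpha> z \<bullet> b) * ((\<beta> z \<bullet> c) * ?H (inv_into U x (fst z)) b c))"
        by (simp add: bilinear_sum[OF B] sum.cartesian_product bilinear_lmul[OF B] bilinear_rmul[OF B]
            mult.left_commute)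
      finally show "(\<Sum>b\<in>Basis. \<Sum>c\<in>Basis. (\<alpha> z \<bullet> b) * ((\<beta> z \<bullet> c) * ?H (inv_into U x (fst z)) b c)) =
          ?H (inv_into U x (fst z)) (\<alpha> z) (\<beta> z)" ..
    qed
  qed
  have Fs: "smooth_on F (x ` U \<times> UNIV)"
    unfolding F_def
    by (intro smooth_on_add o Hs smooth_on_bounded_linear_image[OF o bounded_linear_fst]
        smooth_on_bounded_linear_image[OF o bounded_linear_snd] y z)
  have FI: "F z = g (inv_into ?W ?x z) (Y (inv_into ?W ?x z)) (Z (inv_into ?W ?x z))"
    if z: "z \<in> ?x ` ?W" for z
  proof -
    obtain q where "q \<in> ?W" "z = ?x q" using z by blast
    then show ?thesis by (simp add: F coordinate_system_inv[OF C])
  qed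
  have oW: "open (?x ` ?W)" by (rule coordinate_systemD(3)[OF C])
  have FW: "smooth_on (\<lambda>z. g (inv_into ?W ?x z) (Y (inv_into ?W ?x z)) (Z (inv_into ?W ?x z))) (?x ` ?W)"
    by (rule smooth_on_cong[OF oW FI Fs[folded img]])
  have sn: "smooth_near N u (\<lambda>q. g q (Y q) (Z q))"
    by (rule smooth_nearI[OF NA C u oW _ order_refl FW]) (use u in blast)
  let ?\<xi> = "(0, w)" and ?p = "fst u"
  let ?y' = "frechet_derivative ?y (at (?x u))" and ?z' = "frechet_derivative ?z (at (?x u))"
  have xu: "?x u \<in> x ` U \<times> UNIV" using u img by blast
  have "X u (\<lambda>q. g q (Y q) (Z q)) = frechet_derivative F (at (?x u)) ?\<xi>"
    unfolding X(2)[OF u]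
  proof (rule coord_vector_eqI[OF NA C u sn])
    show "((\<lambda>z. g (inv_into ?W ?x z) (Y (inv_into ?W ?x z)) (Z (inv_into ?W ?x z))) has_derivative
        frechet_derivative F (at (?x u))) (at (?x u))"
      by (rule has_derivative_transform_within_open[OF smooth_on_has_derivative[OF Fs xu] oW _ FI])
        (use u in blast)
  qed
  also have "\<dots> = ?G ?p (?y (?x u)) (?z' ?\<xi>) + ?G ?p (?y' ?\<xi>) (?z (?x u))"
  proof -
    \<comment> \<open>Moving along the fibre fixes the base point. On this line \<open>F\<close> is
      a fixed bilinear form in two moving arguments, and the product rule has no term
      differentiating the metric.\<close>
    have line: "?x u + t *\<^sub>R ?\<xi> \<in> x ` U \<times> UNIV" "fst (?x u + t *\<^sub>R ?\<xi>) = x ?p" for t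
      using fib[OF u] by (auto simp: tangent_coords_def split: prod.splits)
    have Fl: "F (?x u + t *\<^sub>R ?\<xi>) = ?G ?p (?y (?x u + t *\<^sub>R ?\<xi>)) (?z (?x u + t *\<^sub>R ?\<xi>))" for t
      unfolding F_def line(2) coordinate_system_inv[OF x fib(1)[OF u]] ..
    have x0: "?x u + 0 *\<^sub>R ?\<xi> = ?x u" by (simp add: prod_eq_iff)
    have "((\<lambda>t. F (?x u + t *\<^sub>R ?\<xi>)) has_real_derivative frechet_derivative F (at (?x u + 0 *\<^sub>R ?\<xi>)) ?\<xi>) (at 0)"
      using line by (intro has_real_derivative_line smooth_on_differentiable[OF Fs])
    then have 1: "((\<lambda>t. ?G ?p (?y (?x u + t *\<^sub>R ?\<xi>)) (?z (?x u + t *\<^sub>R ?\<xi>))) has_derivative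
        (\<lambda>t. frechet_derivative F (at (?x u)) ?\<xi> * t)) (at 0)"
      unfolding Fl x0 has_field_derivative_def .
    have l: "((\<lambda>t. ?x u + t *\<^sub>R ?\<xi>) has_derivative (\<lambda>t. t *\<^sub>R ?\<xi>)) (at 0)"
      by (auto intro!: derivative_eq_intros)
    have yd: "((\<lambda>t. ?y (?x u + t *\<^sub>R ?\<xi>)) has_derivative (\<lambda>t. ?y' (t *\<^sub>R ?\<xi>))) (at 0)"
      by (rule has_derivative_compose[OF l], unfold x0) (rule smooth_on_has_derivative[OF y xu])
    have zd: "((\<lambda>t. ?z (?x u + t *\<^sub>R ?\<xi>)) has_derivative (\<lambda>t. ?z' (t *\<^sub>R ?\<xi>))) (at 0)"
      by (rule has_derivative_compose[OF l], unfold x0) (rule smooth_on_has_derivative[OF z xu])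
    note B = bounded_bilinear.FDERIV[OF bil[OF fib(1)[OF u]]]
    have "((\<lambda>t. ?G ?p (?y (?x u + t *\<^sub>R ?\<xi>)) (?z (?x u + t *\<^sub>R ?\<xi>))) has_derivative
        (\<lambda>t. (?H ?p (fst (?y (?x u + 0 *\<^sub>R ?\<xi>))) (fst (?z' (t *\<^sub>R ?\<xi>)))
             + ?H ?p (fst (?y' (t *\<^sub>R ?\<xi>))) (fst (?z (?x u + 0 *\<^sub>R ?\<xi>)))) +
             (?H ?p (snd (?y (?x u + 0 *\<^sub>R ?\<xi>))) (snd (?z' (t *\<^sub>R ?\<xi>)))
             + ?H ?p (snd (?y' (t *\<^sub>R ?\<xi>))) (snd (?z (?x u + 0 *\<^sub>R ?\<xi>)))))) (at 0)"
      by (intro has_derivative_add B has_derivative_fst has_derivative_snd yd zd)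
    \<comment> \<open>Both derivatives are linear in the real parameter \<open>t\<close>; comparison
      at \<open>1\<close> yields the directional derivative.\<close>
    from fun_cong[OF has_derivative_unique[OF 1 this[unfolded x0]], of 1] show ?thesis by simp
  qed
  finally have 1: "X u (\<lambda>q. g q (Y q) (Z q)) =
      ?G ?p (?y (?x u)) (?z' ?\<xi>) + ?G ?p (?y' ?\<xi>) (?z (?x u))" .
  \<comment> \<open>The brackets have components \<open>?y' ?\<xi>\<close> and
    \<open>?z' ?\<xi>\<close>, so the subtracted terms are precisely those of the product
    rule.\<close>
  have "lie_bracket N X Y u = ?v u (?y' ?\<xi>)" "lie_bracket N X Z u = ?v u (?z' ?\<xi>)"
    using lie_bracket_constant_field[OF NA C u X] Y Z by auto
  then show ?thesis
    using Yv[OF u] Zv[OF u] gv[OF u] 1 unfolding lie_derivative2_def by simp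
qed

section \<open>Duality of the coordinates and the Hamiltonian field\<close>

lemma uminus_coord_vector:
  assumes "smooth_atlas M" "coordinate_system M U x" "p \<in> U"
  shows "- coord_vector M U x p a = coord_vector M U x p (- a)"
  using coord_vector_linear[OF assms, of "- 1" a 0 0] by (simp add: scale_def fun_eq_iff)

text \<open>Both sides are linear in \<open>v\<close>, so comparison on the
  \<open>y\<close>-coordinate frame suffices, where \<open>dual\<close> applies. \<open>e\<close>
  rewrites the \<open>x\<close>-coordinate vector in \<open>y\<close>, so that bilinearity can be
  used in a single coordinate system.\<close>

lemma metric_coord_field_dual:
  fixes x y :: "'a \<Rightarrow> real^'n"
  assumes M: "smooth_atlas M" and x: "coordinate_system M U x" and y: "coordinate_system M U y"
    and h: "riemannian_metric M h" and p: "p \<in> U" and v: "v \<in> tangent_space M p"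
    and dual: "\<And>j. h p (coord_field M U x i p) (coord_field M U y j p) = (if i = j then 1 else 0)"
  shows "h p (coord_field M U x i p) v = v (\<lambda>q. y q $ i)"
proof -
  define \<phi> where "\<phi> c = h p (coord_field M U x i p) (coord_vector M U y p c)" for c
  define e where "e = vec_coords y (coord_field M U x i p)"
  have "coord_field M U x i p = coord_vector M U y p e"
    using coord_vector_vec_coords[OF M y p coord_vector_tangent[OF M x p]]
    by (simp add: e_def coord_field_eq[OF M x p])
  then have "\<phi> = metric_coords M h U y p e" by (intro ext) (simp add: \<phi>_def metric_coords_def)
  then have l: "linear \<phi>" using bilinear_metric_coords[OF M y p h] by (simp add: bilinear_def)
  have "\<phi> = (\<lambda>c. c $ i)"
  proof (rule linear_eq_stdbasis[OF l])
    show "linear (\<lambda>c::real^'n. c $ i)" by (rule bounded_linear.linear[OF bounded_linear_vec_nth])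
    show "\<phi> b = b $ i" if "b \<in> Basis" for b
      using that dual by (auto simp: Basis_vec_def \<phi>_def coord_field_eq[OF M y p] axis_def)
  qed
  then have "h p (coord_field M U x i p) v = vec_coords y v $ i"
    using coord_vector_vec_coords[OF M y p v] by (metis \<phi>_def)
  also have "\<dots> = v (\<lambda>q. y q $ i)"
    using coord_vector_coordinate[OF M y p, of "vec_coords y v" "axis i 1"]
      coord_vector_vec_coords[OF M y p v] by (simp add: axis_cart_inner)
  finally show ?thesis .
qed

theorem proposition2p28:
  fixes M :: "('a, real^'n) atlas"
    and h :: "'a tensor2"
    and nabla nabla' :: "'a connection"
    and K :: "'a tpoint \<Rightarrow> 'a tpoint tvec \<Rightarrow> 'a tvec"
    and U :: "'a set"
    and x y :: "'a \<Rightarrow> real^'n"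
  assumes "smooth_manifold M"
    and "dually_flat M h nabla nabla'"
    and "connector M nabla K"
    and "affine_coordinates M nabla U x"
    and "affine_coordinates M nabla' U y"
    and "\<forall>i j. \<forall>p\<in>U. h p (coord_field M U x i p) (coord_field M U y j p) = (if i = j then 1 else 0)"
  shows "\<forall>i. kaehler_function (tangent_bundle M) (dombrowski_g M h K) (dombrowski_omega M h K)
           {u \<in> carrier_of (tangent_bundle M). fst u \<in> U} (\<lambda>u. y (fst u) $ i)"
proof
  fix i
  let ?N = "tangent_bundle M" and ?W = "tangent_over M U" and ?x = "tangent_coords x"
  let ?v = "coord_vector ?N ?W ?x"
  have M: "smooth_atlas M" using assms(1) by (simp add: smooth_manifold_def)
  have h: "riemannian_metric M h" and nabla: "affine_connection M nabla"
    using assms(2) by (auto simp: dually_flat_def flat_connection_def)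
  have x: "coordinate_system M U x" and y: "coordinate_system M U y"
    using assms(4,5) by (auto simp: affine_coordinates_def)
  note N = smooth_atlas_tangent_bundle[OF M] and C = coordinate_system_tangent_bundle[OF M x]
  have W: "open_set ?N ?W" by (rule coordinate_systemD(1)[OF C])
  have W_eq: "{u \<in> carrier_of ?N. fst u \<in> U} = ?W"
    using coordinate_systemD(1)[OF x]
    by (auto simp: carrier_of_tangent_bundle tangent_over_def open_set_def)
  have img: "?x ` ?W = x ` U \<times> UNIV" by (simp add: tangent_coords_image[OF M x])
  have fib: "fst u \<in> U" if "u \<in> ?W" for u using that by (auto simp: tangent_over_def)
  note K = connector_coord_vector[OF assms(1) nabla assms(3,4)]
  note dpi = d_pi_coord_vector[OF M x]
  have g: "dombrowski_g M h K u (?v u (a, b)) (?v u (a', b')) =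
      metric_coords M h U x (fst u) a a' + metric_coords M h U x (fst u) b b'"
    if "u \<in> ?W" for u a b a' b'
    by (simp add: dombrowski_g_def dpi[OF that] K[OF that] metric_coords_def)
  have J: "dombrowski_J M K u (?v u (a, b)) = ?v u (- b, a)" if u: "u \<in> ?W" for u a b
    unfolding dombrowski_J_def
  proof (rule the_equality)
    show "?v u (- b, a) \<in> tangent_space ?N u \<and> d_pi M u (?v u (- b, a)) = - K u (?v u (a, b)) \<and>
        K u (?v u (- b, a)) = d_pi M u (?v u (a, b))"
      using coord_vector_tangent[OF N C u]
      by (simp add: dpi[OF u] K[OF u] uminus_coord_vector[OF M x fib[OF u]])
  next
    fix B assume B: "B \<in> tangent_space ?N u \<and> d_pi M u B = - K u (?v u (a, b)) \<and>
        K u B = d_pi M u (?v u (a, b))"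
    then obtain a' b' where ab: "B = ?v u (a', b')"
      using tangent_space_eq_range[OF N C u] by auto
    \<comment> \<open>Uniqueness: \<open>d_pi\<close> and \<open>K\<close> together read off both
      parts of a bundle vector.\<close>
    have "a' = - b" "b' = a"
      using B vec_coords_coord_vector[OF M x fib[OF u]]
      by (auto simp: ab dpi[OF u] K[OF u] uminus_coord_vector[OF M x fib[OF u]]) metis+
    then show "B = ?v u (- b, a)" by (simp add: ab)
  qed
  \<comment> \<open>The sign is dictated by \<open>J\<close>, which maps
    \<open>(0, - axis i 1)\<close> to \<open>(axis i 1, 0)\<close>; pairing with \<open>g\<close>
    then leaves \<open>h\<close> of the coordinate vector with the base part.\<close>
  define X where "X u = (if u \<in> ?W then ?v u (0, - axis i 1) else 0)" for u
  have X: "vector_field ?N ?W X"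
    by (rule vector_field_coordinatesI[OF N C W order_refl, where c = "\<lambda>z. (0, - axis i 1)"])
      (auto simp: X_def smooth_on_const)
  have "dombrowski_omega M h K u (X u) v = v (\<lambda>u. y (fst u) $ i)"
    if u: "u \<in> ?W" and v: "v \<in> tangent_space ?N u" for u v
  proof -
    obtain a b where ab: "v = ?v u (a, b)"
      using v tangent_space_eq_range[OF N C u] by auto
    let ?a = "coord_vector M U x (fst u) a"
    have "dombrowski_omega M h K u (X u) v =
        metric_coords M h U x (fst u) (axis i 1) a + metric_coords M h U x (fst u) 0 b"
      by (simp add: dombrowski_omega_def X_def u J[OF u] ab g[OF u])
    also have "\<dots> = h (fst u) (coord_field M U x i (fst u)) ?a"
      using bilinear_lzero[OF bilinear_metric_coords[OF M x fib[OF u] h]]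
      by (simp add: metric_coords_def coord_field_eq[OF M x fib[OF u]])
    also have "\<dots> = ?a (\<lambda>q. y q $ i)"
      using assms(6) fib[OF u]
      by (intro metric_coord_field_dual[OF M x y h fib[OF u] coord_vector_tangent[OF M x fib[OF u]]]) auto
    also have "\<dots> = d_pi M u v (\<lambda>q. y q $ i)" by (simp add: ab dpi[OF u])
    \<comment> \<open>\<open>push_forward\<close> evaluates the pull-back only on functions smooth
      near the base point, as a component of \<open>y\<close> is.\<close>
    also have "\<dots> = v (\<lambda>u. y (fst u) $ i)"
      using smooth_fun_imp_near[OF smooth_fun_coordinate[OF M y] fib[OF u], of "axis i 1"]
      by (simp add: d_pi_def push_forward_def axis_cart_inner)
    finally show ?thesis .
  qed
  then have ham: "hamiltonian_field ?N ?W (dombrowski_omega M h K) (\<lambda>u. y (fst u) $ i) X"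
    using X by (simp add: hamiltonian_field_def)
  have "smooth_fun ?N ?W (\<lambda>u. y (fst u) $ i)"
  proof (rule smooth_fun_coordinatesI[OF N C W order_refl])
    have o: "open (?x ` ?W)" by (rule coordinate_systemD(3)[OF C])
    have "smooth_on (\<lambda>z. y (inv_into U x z) \<bullet> axis i 1) (x ` U)"
      using smooth_fun_coordinates[OF M x smooth_fun_coordinate[OF M y]] by simp
    then have "smooth_on (\<lambda>z. y (inv_into U x (fst z)) \<bullet> axis i 1) (?x ` ?W)"
      by (intro smooth_on_compose[OF o smooth_on_bounded_linear[OF o bounded_linear_fst]])
        (auto simp: img)
    then show "smooth_on (\<lambda>z. y (fst (inv_into ?W ?x z)) $ i) (?x ` ?W)"
      by (rule smooth_on_cong[OF o, rotated])
        (auto simp: img inv_into_tangent_coords[OF M x] coordinate_system_inv[OF x] axis_cart_inner)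
  qed
  moreover have "lie_derivative2 ?N X (dombrowski_g M h K) Y Z u = 0"
    if "vector_field ?N ?W Y" "vector_field ?N ?W Z" "u \<in> ?W" for Y Z u
    by (rule lie_derivative_vertical[OF M x h g X _ that, where w = "- axis i 1"])
      (auto simp: X_def)
  ultimately show "kaehler_function ?N (dombrowski_g M h K) (dombrowski_omega M h K)
      {u \<in> carrier_of ?N. fst u \<in> U} (\<lambda>u. y (fst u) $ i)"
    unfolding W_eq kaehler_function_def using ham by blast
qed

end
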